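(* Let $\mathbb{G}$ be a stratified Lie group of homogeneous dimension $Q$. Let $0<s<1<p<\infty$, $Q>ps$ and $p<q<p_s^*:=\frac{Qp}{Q-ps}$. Let $\phi$ be a least energy solution of $(-\Delta_{p,\mathbb{G}})^su+|u|^{p-2}u=|u|^{q-2}u$, $u\in W_0^{s,p}(\mathbb{G})$, and let $d=I(\phi)=\inf_{u\in\mathcal{N}}I(u)$. Let $C_{GN,\mathbb{G}}>0$ be the smallest constant $C$ for which the Gagliardo–Nirenberg inequality $$\int_{\mathbb{G}}|u|^qdx\le C\left(\int_{\mathbb{G}}\int_{\mathbb{G}}\frac{|u(x)-u(y)|^p}{|y^{-1}x|^{Q+ps}}dxdy\right)^{\frac{Q(q-p)}{sp^2}}\left(\int_{\mathbb{G}}|u|^pdx\right)^{\frac{spq-Q(q-p)}{sp^2}}$$ holds for all $u\in W_0^{s,p}(\mathbb{G})$, i.e. $$C_{GN,\mathbb{G}}^{-1}=\inf_{u\in W_0^{s,p}(\mathbb{G})\setminus\{0\}}\frac{\left(\int_{\mathbb{G}}\int_{\mathbb{G}}\frac{|u(x)-u(y)|^p}{|y^{-1}x|^{Q+ps}}dxdy\right)^{\frac{Q(q-p)}{sp^2}}\left(\int_{\mathbb{G}}|u|^pdx\right)^{\frac{spq-Q(q-p)}{sp^2}}}{\int_{\mathbb{G}}|u|^qdx}.$$ Then $$C_{GN,\mathbb{G}}^{-1}=\frac{pqs-Q(q-p)}{pqs}\left(\frac{Q(q-p)}{pqs-Q(q-p)}\right)^{\frac{Q(q-p)}{sp^2}}\|\phi\|_{L^p(\mathbb{G})}^{q-p}$$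 $$=\frac{pqs-Q(q-p)}{pqs}\left(\frac{Q(q-p)}{pqs-Q(q-p)}\right)^{\frac{Q(q-p)}{sp^2}}\left(\frac{pqs-Q(q-p)}{(q-p)s}\,d\right)^{\frac{q-p}{p}}.$$
   Context: Stratified Lie group: a Lie group $\mathbb{G}=(\mathbb{R}^N,\circ)$ with a decomposition $\mathbb{R}^N=\mathbb{R}^{N_1}\times\cdots\times\mathbb{R}^{N_k}$ such that (i) for each $\lambda>0$ the dilation $D_\lambda(x)=(\lambda x^{(1)},\lambda^2x^{(2)},\dots,\lambda^kx^{(k)})$, $x^{(i)}\in\mathbb{R}^{N_i}$, is an automorphism of $\mathbb{G}$; (ii) if $X_1,\dots,X_{N_1}$ are the left-invariant vector fields with $X_j(0)=\partial/\partial x_j|_0$, then the Lie algebra they generate has rank $N$ at every point. Its homogeneous dimension is $Q=\sum_{i=1}^k iN_i$. Haar measure $dx$ is Lebesgue measure on $\mathbb{R}^N$. $|\cdot|:\mathbb{G}\to[0,\infty)$ is a fixed homogeneous quasi-norm: continuous, $|x|=0$ iff $x=0$, $|x^{-1}|=|x|$, $|D_\lambda x|=\lambda|x|$ for $\lambda>0$. Write $y^{-1}x=y^{-1}\circ x$. $W^{s,p}(\mathbb{G})=\{u\in L^p(\mathbb{G}):[u]_{s,p}<\infty\}$, with $[u]_{s,p}^p=\iint_{\mathbb{G}\times\mathbb{G}}\frac{|u(x)-u(y)|^p}{|y^{-1}x|^{Q+ps}}dxdy$ and norm $\|u\|_{W^{s,p}}^p=\|u\|_{L^p}^p+[u]_{s,p}^p$;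 $W_0^{s,p}(\mathbb{G})$ is the closure of $C_c^\infty(\mathbb{G})$ in this norm (it equals $W^{s,p}(\mathbb{G})$). The equation is understood weakly: $u\in W_0^{s,p}(\mathbb{G})$ is a weak solution if for all $\psi\in W_0^{s,p}(\mathbb{G})$ $$\iint_{\mathbb{G}\times\mathbb{G}}\frac{|u(x)-u(y)|^{p-2}(u(x)-u(y))(\psi(x)-\psi(y))}{|y^{-1}x|^{Q+ps}}dxdy+\int_{\mathbb{G}}(|u|^{p-2}u\psi-|u|^{q-2}u\psi)dx=0.$$ Energy: $I(u)=\frac1p[u]_{s,p}^p+\frac1p\int_{\mathbb{G}}|u|^pdx-\frac1q\int_{\mathbb{G}}|u|^qdx$ on $W_0^{s,p}(\mathbb{G})$; the left-hand side of the weak formulation is $\langle I'(u),\psi\rangle$. Set $\mathcal{L}(u)=\langle I'(u),u\rangle=[u]_{s,p}^p+\int_{\mathbb{G}}(|u|^p-|u|^q)dx$ and $\mathcal{N}=\{u\in W_0^{s,p}(\mathbb{G})\setminus\{0\}:\mathcal{L}(u)=0\}$. Let $\Gamma$ be the set of nonzero weak solutions. A least energy solution is a $u\in\Gamma$ with $I(u)\le I(v)$ for all $v\in\Gamma$. *)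

theory Defs
  imports "HOL-Analysis.Analysis" "HOL-Algebra.Group"
begin

section \<open>Smooth maps\<close>

primrec continuously_differentiable ::
  "nat \<Rightarrow> ('a::euclidean_space \<Rightarrow> 'b::real_normed_vector) \<Rightarrow> bool" where
  "continuously_differentiable 0 f \<longleftrightarrow> continuous_on UNIV f"
| "continuously_differentiable (Suc m) f \<longleftrightarrow>
     (\<forall>x. f differentiable (at x)) \<and>
     (\<forall>v. continuously_differentiable m (\<lambda>x. frechet_derivative f (at x) v))"

definition smooth_map :: "('a::euclidean_space \<Rightarrow> 'b::real_normed_vector) \<Rightarrow> bool" where
  "smooth_map f \<longleftrightarrow> (\<forall>m. continuously_differentiable m f)"

definition test_functions :: "('a::euclidean_space \<Rightarrow> real) set" where
  "test_functions = {f. smooth_map f \<and> compact (closure {x. f x \<noteq> 0})}"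


section \<open>Stratified Lie groups\<close>

locale lie_group_on_Rn = group G for G :: "(real^'n) monoid" +
  assumes carrier_UNIV: "carrier G = UNIV"
    and smooth_mult: "smooth_map (\<lambda>(x, y). x \<otimes>\<^bsub>G\<^esub> y)"
    and smooth_inv: "smooth_map (\<lambda>x. inv\<^bsub>G\<^esub> x)"

text \<open>
  The decomposition of \<open>\<real>\<^sup>N\<close> into \<open>\<real>\<^bsup>N\<^sub>1\<^esup> \<times> \<dots> \<times> \<real>\<^bsup>N\<^sub>k\<^esup>\<close> is encoded by a map \<open>\<sigma>\<close> from
  coordinates to \<open>{1..k}\<close>: coordinate \<open>j\<close> belongs to the factor number \<open>\<sigma> j\<close>, so that
  \<open>N\<^sub>i = card {j. \<sigma> j = i}\<close>.
\<close>

definition dilation :: "('n \<Rightarrow> nat) \<Rightarrow> real \<Rightarrow> real^'n \<Rightarrow> real^'n" where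
  "dilation \<sigma> r x = (\<chi> j. r ^ \<sigma> j * x $ j)"

definition left_invariant :: "(real^'n) monoid \<Rightarrow> (real^'n \<Rightarrow> real^'n) \<Rightarrow> bool" where
  "left_invariant G X \<longleftrightarrow>
     smooth_map X \<and>
     (\<forall>a x. frechet_derivative (\<lambda>y. a \<otimes>\<^bsub>G\<^esub> y) (at x) (X x) = X (a \<otimes>\<^bsub>G\<^esub> x))"

text \<open>Vector fields \<open>\<Sum>\<^sub>j X\<^sub>j(x) \<partial>\<^sub>j\<close> are identified with their coefficient maps.\<close>

definition lie_bracket ::
  "(real^'n \<Rightarrow> real^'n) \<Rightarrow> (real^'n \<Rightarrow> real^'n) \<Rightarrow> real^'n \<Rightarrow> real^'n" where
  "lie_bracket X Y =
     (\<lambda>x. frechet_derivative Y (at x) (X x) - frechet_derivative X (at x) (Y x))"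

inductive_set lie_algebra_generated ::
  "(real^'n \<Rightarrow> real^'n) set \<Rightarrow> (real^'n \<Rightarrow> real^'n) set"
  for S where
  generator: "X \<in> S \<Longrightarrow> X \<in> lie_algebra_generated S"
| zero: "(\<lambda>x. 0) \<in> lie_algebra_generated S"
| add: "X \<in> lie_algebra_generated S \<Longrightarrow> Y \<in> lie_algebra_generated S \<Longrightarrow>
        (\<lambda>x. X x + Y x) \<in> lie_algebra_generated S"
| scale: "X \<in> lie_algebra_generated S \<Longrightarrow> (\<lambda>x. c *\<^sub>R X x) \<in> lie_algebra_generated S"
| bracket: "X \<in> lie_algebra_generated S \<Longrightarrow> Y \<in> lie_algebra_generated S \<Longrightarrow>
        lie_bracket X Y \<in> lie_algebra_generated S"

definition horizontal_fields ::
  "(real^'n) monoid \<Rightarrow> ('n \<Rightarrow> nat) \<Rightarrow> (real^'n \<Rightarrow> real^'n) set" where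
  "horizontal_fields G \<sigma> = {X. left_invariant G X \<and> (\<exists>j. \<sigma> j = 1 \<and> X 0 = axis j 1)}"

locale stratified_group = lie_group_on_Rn G
  for G :: "(real^'n) monoid" and k :: nat and \<sigma> :: "'n \<Rightarrow> nat" +
  assumes layers: "\<And>j. \<sigma> j \<in> {1..k}"
    and dilation_automorphism: "\<And>r. r > 0 \<Longrightarrow> dilation \<sigma> r \<in> iso G G"
    and full_rank:
      "\<And>x. dim ((\<lambda>X. X x) ` lie_algebra_generated (horizontal_fields G \<sigma>)) = CARD('n)"

definition homogeneous_dim :: "nat \<Rightarrow> ('n \<Rightarrow> nat) \<Rightarrow> nat" where
  "homogeneous_dim k \<sigma> = (\<Sum>i=1..k. i * card {j. \<sigma> j = i})"

definition homogeneous_quasi_norm ::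
  "(real^'n) monoid \<Rightarrow> ('n \<Rightarrow> nat) \<Rightarrow> (real^'n \<Rightarrow> real) \<Rightarrow> bool" where
  "homogeneous_quasi_norm G \<sigma> \<nu> \<longleftrightarrow>
     continuous_on UNIV \<nu> \<and>
     (\<forall>x. \<nu> x \<ge> 0) \<and>
     (\<forall>x. \<nu> x = 0 \<longleftrightarrow> x = 0) \<and>
     (\<forall>x. \<nu> (inv\<^bsub>G\<^esub> x) = \<nu> x) \<and>
     (\<forall>r>0. \<forall>x. \<nu> (dilation \<sigma> r x) = r * \<nu> x)"


section \<open>Fractional Sobolev spaces\<close>

text \<open>
  In what follows \<open>\<nu>\<close> is the quasi-norm and \<open>Q\<close> the homogeneous dimension. Elements of
  \<open>L\<^sup>p\<close> are represented by Borel functions, and the zero element is the class of functions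
  vanishing almost everywhere.
\<close>

definition is_zero :: "(real^'n \<Rightarrow> real) \<Rightarrow> bool" where
  "is_zero u \<longleftrightarrow> (AE x in lborel. u x = 0)"

definition power_integral :: "real \<Rightarrow> (real^'n \<Rightarrow> real) \<Rightarrow> real" where
  "power_integral r u = (LINT x|lborel. \<bar>u x\<bar> powr r)"

definition Lp_norm :: "real \<Rightarrow> (real^'n \<Rightarrow> real) \<Rightarrow> real" where
  "Lp_norm p u = power_integral p u powr (1 / p)"

definition seminorm_integrand ::
  "(real^'n) monoid \<Rightarrow> (real^'n \<Rightarrow> real) \<Rightarrow> real \<Rightarrow> real \<Rightarrow> real \<Rightarrow>
   (real^'n \<Rightarrow> real) \<Rightarrow> (real^'n) \<times> (real^'n) \<Rightarrow> real" where
  "seminorm_integrand G \<nu> Q s p u =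
     (\<lambda>(x, y). \<bar>u x - u y\<bar> powr p / \<nu> (inv\<^bsub>G\<^esub> y \<otimes>\<^bsub>G\<^esub> x) powr (Q + p * s))"

text \<open>This is \<open>[u]\<close> raised to the power \<open>p\<close>.\<close>

definition seminorm_pow ::
  "(real^'n) monoid \<Rightarrow> (real^'n \<Rightarrow> real) \<Rightarrow> real \<Rightarrow> real \<Rightarrow> real \<Rightarrow> (real^'n \<Rightarrow> real) \<Rightarrow> real" where
  "seminorm_pow G \<nu> Q s p u =
     (LINT z|(lborel \<Otimes>\<^sub>M lborel). seminorm_integrand G \<nu> Q s p u z)"

definition W ::
  "(real^'n) monoid \<Rightarrow> (real^'n \<Rightarrow> real) \<Rightarrow> real \<Rightarrow> real \<Rightarrow> real \<Rightarrow> (real^'n \<Rightarrow> real) set" where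
  "W G \<nu> Q s p =
     {u. u \<in> borel_measurable lborel \<and>
         integrable lborel (\<lambda>x. \<bar>u x\<bar> powr p) \<and>
         integrable (lborel \<Otimes>\<^sub>M lborel) (seminorm_integrand G \<nu> Q s p u)}"

definition W_norm ::
  "(real^'n) monoid \<Rightarrow> (real^'n \<Rightarrow> real) \<Rightarrow> real \<Rightarrow> real \<Rightarrow> real \<Rightarrow> (real^'n \<Rightarrow> real) \<Rightarrow> real" where
  "W_norm G \<nu> Q s p u = (power_integral p u + seminorm_pow G \<nu> Q s p u) powr (1 / p)"

text \<open>
  The intersection of the test functions with \<open>W\<close> is no restriction, since
  \<open>C\<^sub>c\<^sup>\<infinity> \<subseteq> W\<close> for \<open>0 < s < 1 < p\<close>; it ensures that \<^const>\<open>W_norm\<close> is only applied to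
  elements of \<open>W\<close>.
\<close>

definition W0 ::
  "(real^'n) monoid \<Rightarrow> (real^'n \<Rightarrow> real) \<Rightarrow> real \<Rightarrow> real \<Rightarrow> real \<Rightarrow> (real^'n \<Rightarrow> real) set" where
  "W0 G \<nu> Q s p =
     {u \<in> W G \<nu> Q s p.
        \<forall>\<epsilon>>0. \<exists>\<psi> \<in> test_functions \<inter> W G \<nu> Q s p. W_norm G \<nu> Q s p (\<lambda>x. u x - \<psi> x) < \<epsilon>}"


section \<open>The equation, its energy and the Nehari set\<close>

text \<open>
  For exponents \<open>p - 2 < 0\<close> the product \<open>\<bar>t\<bar>\<^bsup>p-2\<^esup> t\<close> is read as \<open>0\<close> at \<open>t = 0\<close>, in
  agreement with \<open>0 powr a = 0\<close>.
\<close>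

definition weak_form ::
  "(real^'n) monoid \<Rightarrow> (real^'n \<Rightarrow> real) \<Rightarrow> real \<Rightarrow> real \<Rightarrow> real \<Rightarrow> real \<Rightarrow>
   (real^'n \<Rightarrow> real) \<Rightarrow> (real^'n \<Rightarrow> real) \<Rightarrow> real" where
  "weak_form G \<nu> Q s p q u \<psi> =
     (LINT z|(lborel \<Otimes>\<^sub>M lborel).
        (\<lambda>(x, y). \<bar>u x - u y\<bar> powr (p - 2) * (u x - u y) * (\<psi> x - \<psi> y)
                 / \<nu> (inv\<^bsub>G\<^esub> y \<otimes>\<^bsub>G\<^esub> x) powr (Q + p * s)) z)
     + (LINT x|lborel. \<bar>u x\<bar> powr (p - 2) * u x * \<psi> x - \<bar>u x\<bar> powr (q - 2) * u x * \<psi> x)"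

definition weak_solution ::
  "(real^'n) monoid \<Rightarrow> (real^'n \<Rightarrow> real) \<Rightarrow> real \<Rightarrow> real \<Rightarrow> real \<Rightarrow> real \<Rightarrow>
   (real^'n \<Rightarrow> real) \<Rightarrow> bool" where
  "weak_solution G \<nu> Q s p q u \<longleftrightarrow>
     u \<in> W0 G \<nu> Q s p \<and> (\<forall>\<psi> \<in> W0 G \<nu> Q s p. weak_form G \<nu> Q s p q u \<psi> = 0)"

definition energy ::
  "(real^'n) monoid \<Rightarrow> (real^'n \<Rightarrow> real) \<Rightarrow> real \<Rightarrow> real \<Rightarrow> real \<Rightarrow> real \<Rightarrow>
   (real^'n \<Rightarrow> real) \<Rightarrow> real" where
  "energy G \<nu> Q s p q u =
     1 / p * seminorm_pow G \<nu> Q s p u + 1 / p * power_integral p u - 1 / q * power_integral q u"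

definition nehari_functional ::
  "(real^'n) monoid \<Rightarrow> (real^'n \<Rightarrow> real) \<Rightarrow> real \<Rightarrow> real \<Rightarrow> real \<Rightarrow> real \<Rightarrow>
   (real^'n \<Rightarrow> real) \<Rightarrow> real" where
  "nehari_functional G \<nu> Q s p q u =
     seminorm_pow G \<nu> Q s p u + (LINT x|lborel. \<bar>u x\<bar> powr p - \<bar>u x\<bar> powr q)"

definition nehari_set ::
  "(real^'n) monoid \<Rightarrow> (real^'n \<Rightarrow> real) \<Rightarrow> real \<Rightarrow> real \<Rightarrow> real \<Rightarrow> real \<Rightarrow>
   (real^'n \<Rightarrow> real) set" where
  "nehari_set G \<nu> Q s p q =
     {u \<in> W0 G \<nu> Q s p. \<not> is_zero u \<and> nehari_functional G \<nu> Q s p q u = 0}"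

definition nonzero_solutions ::
  "(real^'n) monoid \<Rightarrow> (real^'n \<Rightarrow> real) \<Rightarrow> real \<Rightarrow> real \<Rightarrow> real \<Rightarrow> real \<Rightarrow>
   (real^'n \<Rightarrow> real) set" where
  "nonzero_solutions G \<nu> Q s p q = {u. weak_solution G \<nu> Q s p q u \<and> \<not> is_zero u}"

definition least_energy_solution ::
  "(real^'n) monoid \<Rightarrow> (real^'n \<Rightarrow> real) \<Rightarrow> real \<Rightarrow> real \<Rightarrow> real \<Rightarrow> real \<Rightarrow>
   (real^'n \<Rightarrow> real) \<Rightarrow> bool" where
  "least_energy_solution G \<nu> Q s p q u \<longleftrightarrow>
     u \<in> nonzero_solutions G \<nu> Q s p q \<and>
     (\<forall>v \<in> nonzero_solutions G \<nu> Q s p q. energy G \<nu> Q s p q u \<le> energy G \<nu> Q s p q v)"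


section \<open>The Gagliardo--Nirenberg constant\<close>

definition gn_product ::
  "(real^'n) monoid \<Rightarrow> (real^'n \<Rightarrow> real) \<Rightarrow> real \<Rightarrow> real \<Rightarrow> real \<Rightarrow> real \<Rightarrow>
   (real^'n \<Rightarrow> real) \<Rightarrow> real" where
  "gn_product G \<nu> Q s p q u =
     seminorm_pow G \<nu> Q s p u powr (Q * (q - p) / (s * p\<^sup>2)) *
     power_integral p u powr ((s * p * q - Q * (q - p)) / (s * p\<^sup>2))"

text \<open>
  The left-hand side of the inequality is taken in \<open>[0, \<infinity>]\<close>, so that the inequality
  includes the finiteness of the integral of \<open>\<bar>u\<bar>\<^sup>q\<close>.
\<close>

definition gn_inequality ::
  "(real^'n) monoid \<Rightarrow> (real^'n \<Rightarrow> real) \<Rightarrow> real \<Rightarrow> real \<Rightarrow> real \<Rightarrow> real \<Rightarrow> real \<Rightarrow> bool" where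
  "gn_inequality G \<nu> Q s p q C \<longleftrightarrow>
     (\<forall>u \<in> W0 G \<nu> Q s p.
        (\<integral>\<^sup>+ x. ennreal (\<bar>u x\<bar> powr q) \<partial>lborel) \<le> ennreal (C * gn_product G \<nu> Q s p q u))"

definition gn_constant ::
  "(real^'n) monoid \<Rightarrow> (real^'n \<Rightarrow> real) \<Rightarrow> real \<Rightarrow> real \<Rightarrow> real \<Rightarrow> real \<Rightarrow> real" where
  "gn_constant G \<nu> Q s p q = (LEAST C. C > 0 \<and> gn_inequality G \<nu> Q s p q C)"

end

theory Submission
  imports Defs "HOL-Real_Asymp.Real_Asymp"
begin

text \<open>
  For \<open>u \<noteq> 0\<close> in \<open>L\<^sup>q\<close> a multiple of \<open>u \<circ> D\<^sub>r\<close> lies on the Nehari set, so its energy is at least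
  that of \<open>\<phi>\<close>. With \<open>t = r\<^bsup>ps\<^esup>\<close> and \<open>\<theta> = Q(q - p)/(pqs)\<close> this reads
  \<open>(\<integral>\<bar>\<phi>\<bar>\<^sup>q)\<^bsup>(q-p)/q\<^esup> (\<integral>\<bar>u\<bar>\<^sup>q)\<^bsup>p/q\<^esup> \<le> (t [u]\<^sup>p + \<integral>\<bar>u\<bar>\<^sup>p) t\<^bsup>-\<theta>\<^esup>\<close> for all \<open>t > 0\<close>. For \<open>u = \<phi>\<close> there is
  equality at \<open>t = 1\<close>, so the derivative vanishes there, which is the Pohozaev identity
  \<open>(1 - \<theta>) [\<phi>]\<^sup>p = \<theta> \<integral>\<bar>\<phi>\<bar>\<^sup>p\<close>; for general \<open>u\<close> minimizing over \<open>t\<close> gives the Gagliardo--Nirenberg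
  inequality with equality at \<open>\<phi>\<close>. This argument presupposes \<open>u \<in> L\<^sup>q\<close>. It applies to test functions,
  and density together with Fatou's lemma extends the inequality to the whole space, so that no Sobolev
  embedding is needed beforehand.
\<close>

section \<open>Dilations\<close>

lemma continuously_differentiable_scaled_compose:
  fixes f :: "'a::euclidean_space \<Rightarrow> 'b::real_normed_vector" and L :: "'c::euclidean_space \<Rightarrow> 'a"
  assumes L: "bounded_linear L" and f: "continuously_differentiable m f"
  shows "continuously_differentiable m (\<lambda>x. c *\<^sub>R f (L x))"
  using f
proof (induction m arbitrary: f)
  case 0
  then show ?case
    using continuous_on_compose2[of UNIV f UNIV L] linear_continuous_on[OF L]
    by (auto intro: continuous_on_scaleR continuous_on_const)
next
  case (Suc m)
  \<comment> \<open>For fixed \<open>v\<close> the derivative is again of the form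
    \<open>c *\<^sub>R g (L x)\<close>, with \<open>g\<close> the directional derivative of
    \<open>f\<close> along \<open>L v\<close>. The induction hypothesis for arbitrary
    \<open>f\<close> therefore applies to it.\<close>
  have D: "((\<lambda>x. c *\<^sub>R f (L x)) has_derivative
      (\<lambda>v. c *\<^sub>R frechet_derivative f (at (L x)) (L v))) (at x)" for x
  proof -
    have "(f has_derivative frechet_derivative f (at (L x))) (at (L x))"
      using Suc.prems by (simp add: frechet_derivative_works)
    then have "(f \<circ> L has_derivative frechet_derivative f (at (L x)) \<circ> L) (at x)"
      by (rule diff_chain_at[OF bounded_linear_imp_has_derivative[OF L]])
    then show ?thesis
      by (auto intro!: derivative_eq_intros simp: o_def)
  qed
  then have eq: "frechet_derivative (\<lambda>x. c *\<^sub>R f (L x)) (at x) v =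
      c *\<^sub>R frechet_derivative f (at (L x)) (L v)" for x v
    by (metis frechet_derivative_at)
  show ?case
    using Suc D by (auto simp: differentiable_def eq)
qed

lemma smooth_map_scaled_compose:
  fixes f :: "'a::euclidean_space \<Rightarrow> 'b::real_normed_vector" and L :: "'c::euclidean_space \<Rightarrow> 'a"
  assumes "bounded_linear L" "smooth_map f"
  shows "smooth_map (\<lambda>x. c *\<^sub>R f (L x))"
  using assms by (simp add: smooth_map_def continuously_differentiable_scaled_compose)

lemma smooth_map_continuous: "smooth_map f \<Longrightarrow> continuous_on UNIV f"
  unfolding smooth_map_def using continuously_differentiable.simps(1) by blast

lemma bounded_linear_dilation: "bounded_linear (dilation \<sigma> r)"
  unfolding dilation_def
  by (intro linear_conv_bounded_linear[THEN iffD1] linearI)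
     (auto simp: vec_eq_iff algebra_simps)

lemma borel_measurable_dilation [measurable]: "dilation \<sigma> r \<in> borel_measurable borel"
  by (intro borel_measurable_continuous_onI linear_continuous_on bounded_linear_dilation)

lemma dilation_inverse: "r \<noteq> 0 \<Longrightarrow> dilation \<sigma> (inverse r) (dilation \<sigma> r x) = x"
  by (simp add: dilation_def vec_eq_iff flip: power_mult_distrib mult.assoc)

text \<open>Compactness of a closure in finite dimension amounts to boundedness, and the points
  where the new function is nonzero lie in the image of a bounded set under the inverse dilation, a
  bounded linear map.\<close>

lemma test_functions_scaled_dilation:
  assumes f: "f \<in> test_functions" and r: "r > 0"
  shows "(\<lambda>x. c * f (dilation \<sigma> r x)) \<in> test_functions"
proof -
  have "smooth_map (\<lambda>x. c * f (dilation \<sigma> r x))"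
    using smooth_map_scaled_compose[OF bounded_linear_dilation, of f c] f
    by (simp add: test_functions_def)
  moreover have "bounded {x. f x \<noteq> 0}"
    using f compact_imp_bounded bounded_subset[OF _ closure_subset]
    by (auto simp: test_functions_def)
  then have "bounded (dilation \<sigma> (inverse r) ` {x. f x \<noteq> 0})"
    by (intro bounded_linear_image bounded_linear_dilation)
  then have "bounded {x. c * f (dilation \<sigma> r x) \<noteq> 0}"
    by (rule bounded_subset)
       (use r in \<open>auto intro!: image_eqI dilation_inverse[symmetric]\<close>)
  ultimately show ?thesis
    by (simp add: test_functions_def)
qed

lemma bounded_test_function:
  assumes "f \<in> test_functions"
  obtains M where "M > 0" "\<And>x. \<bar>f x\<bar> \<le> M"
proof -
  have "continuous_on (closure {x. f x \<noteq> 0}) f"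
    using assms smooth_map_continuous[of f] continuous_on_subset[of UNIV f]
    by (simp add: test_functions_def)
  then have "bounded (f ` closure {x. f x \<noteq> 0})"
    using assms compact_continuous_image[of "closure {x. f x \<noteq> 0}" f] compact_imp_bounded
    by (auto simp: test_functions_def)
  then obtain M where M: "M > 0" "\<And>x. x \<in> closure {x. f x \<noteq> 0} \<Longrightarrow> \<bar>f x\<bar> \<le> M"
    unfolding bounded_pos by auto
  have "\<bar>f x\<bar> \<le> M" for x
    using M(1) M(2)[of x] closure_subset[of "{x. f x \<noteq> 0}"] by (cases "f x = 0") auto
  then show ?thesis
    using that M(1) by blast
qed

section \<open>Change of variables under dilations\<close>

lemma homogeneous_dim_eq_sum:
  fixes \<sigma> :: "'n::finite \<Rightarrow> nat"
  assumes "\<And>j. \<sigma> j \<in> {1..k}"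
  shows "homogeneous_dim k \<sigma> = (\<Sum>j\<in>UNIV. \<sigma> j)"
proof -
  have "(\<Sum>j\<in>UNIV. \<sigma> j) = (\<Sum>i\<in>{1..k}. \<Sum>j\<in>{j\<in>UNIV. \<sigma> j = i}. \<sigma> j)"
    using assms by (subst sum.group) auto
  then show ?thesis
    by (simp add: homogeneous_dim_def mult.commute)
qed

lemma nn_integral_dilation:
  fixes \<sigma> :: "'n::finite \<Rightarrow> nat"
  assumes [measurable]: "f \<in> borel_measurable borel" and r: "r > 0"
  shows "(\<integral>\<^sup>+x. f x \<partial>lborel) =
    ennreal (r ^ (\<Sum>j\<in>UNIV. \<sigma> j)) * (\<integral>\<^sup>+x. f (dilation \<sigma> r x) \<partial>lborel)"
proof -
  \<comment> \<open>\<open>lborel_affine_euclidean\<close> wants scaling factors indexed by basis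
    vectors, so the coordinate is recovered from the basis vector. The Jacobian is then the product
    of the factors \<open>r ^ \<sigma> j\<close>.\<close>
  define c where "c b = r ^ \<sigma> (THE j. b = axis j (1::real))" for b
  have c: "c (axis j 1) = r ^ \<sigma> j" for j
    unfolding c_def by (subst the_equality[where a = j]) (auto simp: axis_eq_axis)
  have inj: "inj (\<lambda>j. axis j (1::real))"
    by (auto intro!: injI simp: axis_eq_axis)
  have B: "(Basis :: (real^'n) set) = range (\<lambda>j. axis j 1)"
    by (auto simp: Basis_vec_def)
  have "0 + (\<Sum>b\<in>Basis. (c b * (x \<bullet> b)) *\<^sub>R b) = dilation \<sigma> r x" for x
    unfolding B using inj
    by (subst sum.reindex)
       (simp_all add: c inner_axis vec_eq_iff dilation_def, simp add: axis_def if_distrib cong: if_cong)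
  moreover have "(\<Prod>b\<in>(Basis :: (real^'n) set). \<bar>c b\<bar>) = r ^ (\<Sum>j\<in>UNIV. \<sigma> j)"
    unfolding B using inj r by (subst prod.reindex) (auto simp: c power_sum)
  moreover have "c b \<noteq> 0" for b
    using r by (simp add: c_def)
  ultimately have *:
    "lborel = density (distr lborel borel (dilation \<sigma> r)) (\<lambda>_. r ^ (\<Sum>j\<in>UNIV. \<sigma> j))"
    using lborel_affine_euclidean[of c 0] by simp
  show ?thesis
    by (subst arg_cong[OF *, of "\<lambda>M. integral\<^sup>N M f"])
       (simp add: nn_integral_density nn_integral_distr nn_integral_cmult)
qed

text \<open>By Tonelli the one-variable formula can be applied to \<open>y\<close> and then to
  \<open>x\<close>, each contributing one Jacobian.\<close>

lemma nn_integral_dilation_pair: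
  fixes \<sigma> :: "'n::finite \<Rightarrow> nat"
  assumes [measurable]: "f \<in> borel_measurable (lborel \<Otimes>\<^sub>M lborel)" and r: "r > 0"
  shows "(\<integral>\<^sup>+z. f z \<partial>(lborel \<Otimes>\<^sub>M lborel)) =
    ennreal (r ^ (\<Sum>j\<in>UNIV. \<sigma> j)) * (ennreal (r ^ (\<Sum>j\<in>UNIV. \<sigma> j)) *
    (\<integral>\<^sup>+z. f (dilation \<sigma> r (fst z), dilation \<sigma> r (snd z)) \<partial>(lborel \<Otimes>\<^sub>M lborel)))"
proof -
  let ?c = "ennreal (r ^ (\<Sum>j\<in>UNIV. \<sigma> j))" and ?D = "dilation \<sigma> r"
  have [measurable]: "?D \<in> lborel \<rightarrow>\<^sub>M lborel"
    using borel_measurable_dilation by simp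
  have "(\<integral>\<^sup>+z. f z \<partial>(lborel \<Otimes>\<^sub>M lborel)) = (\<integral>\<^sup>+x. \<integral>\<^sup>+y. f (x, y) \<partial>lborel \<partial>lborel)"
    by (subst lborel.nn_integral_fst[symmetric]) auto
  also have "\<dots> = (\<integral>\<^sup>+x. ?c * (\<integral>\<^sup>+y. f (x, ?D y) \<partial>lborel) \<partial>lborel)"
  proof (rule nn_integral_cong)
    fix x :: "real^'n"
    have "(\<lambda>y. f (x, y)) \<in> borel_measurable lborel"
      by measurable
    then show "(\<integral>\<^sup>+y. f (x, y) \<partial>lborel) = ?c * (\<integral>\<^sup>+y. f (x, ?D y) \<partial>lborel)"
      by (subst nn_integral_dilation[OF _ r, of "\<lambda>y. f (x, y)" \<sigma>]) auto
  qed
  also have "\<dots> = ?c * (\<integral>\<^sup>+x. \<integral>\<^sup>+y. f (x, ?D y) \<partial>lborel \<partial>lborel)"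
    by (rule nn_integral_cmult) measurable
  also have "(\<integral>\<^sup>+x. \<integral>\<^sup>+y. f (x, ?D y) \<partial>lborel \<partial>lborel) =
      ?c * (\<integral>\<^sup>+x. \<integral>\<^sup>+y. f (?D x, ?D y) \<partial>lborel \<partial>lborel)"
  proof -
    have "(\<lambda>x. \<integral>\<^sup>+y. f (x, ?D y) \<partial>lborel) \<in> borel_measurable lborel"
      by measurable
    then show ?thesis
      by (subst nn_integral_dilation[OF _ r, of "\<lambda>x. \<integral>\<^sup>+y. f (x, ?D y) \<partial>lborel" \<sigma>]) auto
  qed
  also have "(\<integral>\<^sup>+x. \<integral>\<^sup>+y. f (?D x, ?D y) \<partial>lborel \<partial>lborel) =
      (\<integral>\<^sup>+z. f (?D (fst z), ?D (snd z)) \<partial>(lborel \<Otimes>\<^sub>M lborel))"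
    by (subst lborel.nn_integral_fst[symmetric]) auto
  finally show ?thesis .
qed

text \<open>Bridge from changes of variables for nonnegative integrals to Bochner integrals: since
  \<open>c\<close> is positive, finiteness of the integral of \<open>f\<close> forces that of
  \<open>g\<close>.\<close>

lemma integral_rescale:
  fixes f g :: "'a \<Rightarrow> real"
  assumes f: "integrable M f" and nonneg: "\<And>x. f x \<ge> 0" "\<And>x. g x \<ge> 0"
    and [measurable]: "g \<in> borel_measurable M" and c: "c > 0"
    and eq: "(\<integral>\<^sup>+x. ennreal (f x) \<partial>M) = ennreal c * (\<integral>\<^sup>+x. ennreal (g x) \<partial>M)"
  shows "integrable M g" "integral\<^sup>L M g = integral\<^sup>L M f / c"
proof -
  have eq': "ennreal (integral\<^sup>L M f) = ennreal c * (\<integral>\<^sup>+x. ennreal (g x) \<partial>M)"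
    using nn_integral_eq_integral[OF f] nonneg eq by auto
  then have "(\<integral>\<^sup>+x. ennreal (g x) \<partial>M) < \<infinity>"
    using c by (metis ennreal_less_top ennreal_mult_eq_top_iff ennreal_eq_0_iff infinity_ennreal_def
        less_top not_le)
  then show g: "integrable M g"
    using nonneg by (auto simp: integrable_iff_bounded)
  have "ennreal (integral\<^sup>L M f) = ennreal (c * integral\<^sup>L M g)"
    using nn_integral_eq_integral[OF g] nonneg eq' c by (auto simp: ennreal_mult)
  then show "integral\<^sup>L M g = integral\<^sup>L M f / c"
    using c nonneg by (subst (asm) ennreal_inj) (auto simp: field_simps)
qed

text \<open>Convexity at the combination of \<open>\<bar>a\<bar> / (1 - t)\<close> and
  \<open>\<bar>b\<bar> / t\<close> with weights \<open>1 - t\<close> and \<open>t\<close>. As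
  \<open>t\<close> tends to 0 the coefficient of the first term tends to 1, so a small perturbation
  \<open>b\<close> barely disturbs the bound.\<close>

lemma powr_abs_add_le:
  fixes a b t p :: real
  assumes t: "0 < t" "t < 1" and p: "1 \<le> p"
  shows "\<bar>a + b\<bar> powr p \<le> (1 - t) powr (1 - p) * \<bar>a\<bar> powr p + t powr (1 - p) * \<bar>b\<bar> powr p"
proof -
  have ge1: "1 \<le> r powr (1 - p)" if "0 < r" "r < 1" for r :: real
    using powr_mono_both'[of 0 "p - 1" r 1] powr_mono'[of "1 - p" 0 r] that p by simp
  show ?thesis
  proof (cases "a = 0 \<or> b = 0")
    \<comment> \<open>With one summand zero the bound is immediate, because both coefficients are at
      least 1.\<close>
    case True
    then show ?thesis
      using ge1[of t] ge1[of "1 - t"] t p mult_right_mono[of 1 _ "\<bar>a\<bar> powr p"]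
        mult_right_mono[of 1 _ "\<bar>b\<bar> powr p"] by auto
  next
    case False
    have "\<bar>a + b\<bar> powr p \<le> ((1 - t) * (\<bar>a\<bar> / (1 - t)) + t * (\<bar>b\<bar> / t)) powr p"
      using t p by (intro powr_mono2) auto
    also have "\<dots> \<le> (1 - t) * (\<bar>a\<bar> / (1 - t)) powr p + t * (\<bar>b\<bar> / t) powr p"
      using convex_onD[OF powr_convex[OF p], of t "\<bar>a\<bar> / (1 - t)" "\<bar>b\<bar> / t"] t False by simp
    also have "\<dots> = (1 - t) powr (1 - p) * \<bar>a\<bar> powr p + t powr (1 - p) * \<bar>b\<bar> powr p"
      using t by (simp add: powr_divide powr_diff)
    finally show ?thesis .
  qed
qed

section \<open>Scaling in fractional Sobolev spaces\<close>

locale fractional_sobolev = stratified_group G k \<sigma>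
  for G :: "(real^'n) monoid" and k :: nat and \<sigma> :: "'n \<Rightarrow> nat" +
  fixes \<nu> :: "real^'n \<Rightarrow> real" and Q s p :: real
  assumes Q_eq: "Q = real (homogeneous_dim k \<sigma>)"
    and quasi_norm: "homogeneous_quasi_norm G \<sigma> \<nu>"
    and s_pos: "0 < s" and p_gt_1: "1 < p"
begin

abbreviation integrand :: "(real^'n \<Rightarrow> real) \<Rightarrow> (real^'n) \<times> (real^'n) \<Rightarrow> real" where
  "integrand \<equiv> seminorm_integrand G \<nu> Q s p"

abbreviation semi :: "(real^'n \<Rightarrow> real) \<Rightarrow> real" where
  "semi \<equiv> seminorm_pow G \<nu> Q s p"

abbreviation Wsp :: "(real^'n \<Rightarrow> real) set" where
  "Wsp \<equiv> W G \<nu> Q s p"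

abbreviation W0sp :: "(real^'n \<Rightarrow> real) set" where
  "W0sp \<equiv> W0 G \<nu> Q s p"

abbreviation Wnorm :: "(real^'n \<Rightarrow> real) \<Rightarrow> real" where
  "Wnorm \<equiv> W_norm G \<nu> Q s p"

section \<open>Homogeneity of the group and of the kernel\<close>

lemma power_sum_layers: "r > 0 \<Longrightarrow> r ^ (\<Sum>j\<in>UNIV. \<sigma> j) = r powr Q"
  using homogeneous_dim_eq_sum[of \<sigma> k] layers by (simp add: Q_eq powr_realpow del: of_nat_sum)

lemma Q_pos: "Q > 0"
proof -
  have "(\<Sum>j\<in>UNIV. \<sigma> j) > 0"
    using layers by (intro sum_pos) (auto simp: Suc_le_eq)
  then show ?thesis
    using homogeneous_dim_eq_sum[of \<sigma> k] layers by (simp add: Q_eq del: of_nat_sum)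
qed

lemma dilation_hom: "r > 0 \<Longrightarrow> group_hom G G (dilation \<sigma> r)"
  using dilation_automorphism[of r]
  by (intro group_hom.intro group_hom_axioms.intro is_group) (auto simp: iso_def)

text \<open>The automorphism \<open>dilation \<sigma> 2\<close> fixes the identity but multiplies
  each coordinate by a number greater than 1. This ties the zero of \<open>\<nu>\<close> to the
  group identity.\<close>

lemma one_eq_zero: "\<one>\<^bsub>G\<^esub> = 0"
proof -
  have "dilation \<sigma> 2 \<one>\<^bsub>G\<^esub> = \<one>\<^bsub>G\<^esub>"
    using group_hom.hom_one[OF dilation_hom[of 2]] by simp
  then have "2 ^ \<sigma> j * \<one>\<^bsub>G\<^esub> $ j = \<one>\<^bsub>G\<^esub> $ j" for j
    by (simp add: dilation_def vec_eq_iff)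
  moreover have "(2::real) ^ \<sigma> j > 1" for j
    using layers[of j] by (intro one_less_power) auto
  then have "(2::real) ^ \<sigma> j \<noteq> 1" for j
    by (rule less_imp_neq[symmetric])
  ultimately show ?thesis
    by (simp add: vec_eq_iff)
qed

lemma \<nu>_nonneg: "\<nu> x \<ge> 0"
  using quasi_norm by (simp add: homogeneous_quasi_norm_def)

lemma \<nu>_diff_eq_0_iff: "\<nu> (inv\<^bsub>G\<^esub> y \<otimes>\<^bsub>G\<^esub> x) = 0 \<longleftrightarrow> x = y"
proof -
  have "inv\<^bsub>G\<^esub> y \<otimes>\<^bsub>G\<^esub> x = \<one>\<^bsub>G\<^esub> \<longleftrightarrow> x = y"
    by (metis UNIV_I carrier_UNIV inv_closed inv_equality inv_inv l_inv)
  then show ?thesis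
    using quasi_norm by (simp add: homogeneous_quasi_norm_def one_eq_zero)
qed

lemma \<nu>_diff_dilation:
  assumes r: "r > 0"
  shows "\<nu> (inv\<^bsub>G\<^esub> (dilation \<sigma> r y) \<otimes>\<^bsub>G\<^esub> dilation \<sigma> r x) = r * \<nu> (inv\<^bsub>G\<^esub> y \<otimes>\<^bsub>G\<^esub> x)"
proof -
  interpret D: group_hom G G "dilation \<sigma> r"
    by (rule dilation_hom[OF r])
  have "inv\<^bsub>G\<^esub> (dilation \<sigma> r y) \<otimes>\<^bsub>G\<^esub> dilation \<sigma> r x = dilation \<sigma> r (inv\<^bsub>G\<^esub> y \<otimes>\<^bsub>G\<^esub> x)"
    by (simp add: carrier_UNIV D.hom_inv D.hom_mult)
  then show ?thesis
    using quasi_norm r by (simp add: homogeneous_quasi_norm_def)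
qed

lemma borel_measurable_\<nu>_diff:
  "(\<lambda>z. \<nu> (inv\<^bsub>G\<^esub> (snd z) \<otimes>\<^bsub>G\<^esub> fst z)) \<in> borel_measurable (lborel \<Otimes>\<^sub>M lborel)"
proof -
  have "continuous_on UNIV (\<lambda>z. (inv\<^bsub>G\<^esub> (snd z), fst z))"
    by (intro continuous_on_Pair continuous_on_compose2[OF smooth_map_continuous[OF smooth_inv]]
        continuous_on_fst continuous_on_snd continuous_on_id) auto
  then have "continuous_on UNIV (\<lambda>z. inv\<^bsub>G\<^esub> (snd z) \<otimes>\<^bsub>G\<^esub> fst z)"
    using continuous_on_compose2[OF smooth_map_continuous[OF smooth_mult]] by fastforce
  then have "continuous_on UNIV (\<lambda>z. \<nu> (inv\<^bsub>G\<^esub> (snd z) \<otimes>\<^bsub>G\<^esub> fst z))"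
    using quasi_norm continuous_on_compose2[of UNIV \<nu> UNIV]
    by (auto simp: homogeneous_quasi_norm_def)
  then show ?thesis
    using borel_measurable_continuous_onI by (simp add: lborel_prod)
qed

lemma integrand_eq:
  "integrand u z = \<bar>u (fst z) - u (snd z)\<bar> powr p / \<nu> (inv\<^bsub>G\<^esub> (snd z) \<otimes>\<^bsub>G\<^esub> fst z) powr (Q + p * s)"
  by (simp add: seminorm_integrand_def split: prod.split)

lemma integrand_nonneg: "integrand u z \<ge> 0"
  by (simp add: integrand_eq)

lemma borel_measurable_integrand:
  assumes [measurable]: "u \<in> borel_measurable borel"
  shows "integrand u \<in> borel_measurable (lborel \<Otimes>\<^sub>M lborel)"
proof -
  note borel_measurable_\<nu>_diff [measurable]
  have [measurable]: "u \<in> borel_measurable lborel"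
    by simp
  show ?thesis
    unfolding integrand_eq[abs_def] by measurable
qed

lemma semi_nonneg: "semi u \<ge> 0"
  by (simp add: seminorm_pow_def integrand_nonneg)

lemma power_integral_nonneg: "power_integral t u \<ge> 0"
  by (simp add: power_integral_def)

section \<open>Sums and differences, with convexity bounds\<close>

lemma WspD:
  assumes "u \<in> Wsp"
  shows "u \<in> borel_measurable borel" "integrable lborel (\<lambda>x. \<bar>u x\<bar> powr p)"
    "integrable (lborel \<Otimes>\<^sub>M lborel) (integrand u)"
  using assms by (auto simp: W_def)

lemma integrand_add_le:
  assumes t: "0 < t" "t < 1"
  shows "integrand (\<lambda>x. u x + v x) z \<le>
    (1 - t) powr (1 - p) * integrand u z + t powr (1 - p) * integrand v z"
proof -
  have "\<bar>(u x + v x) - (u y + v y)\<bar> powr p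
      \<le> (1 - t) powr (1 - p) * \<bar>u x - u y\<bar> powr p + t powr (1 - p) * \<bar>v x - v y\<bar> powr p" for x y
    using powr_abs_add_le[OF t, of p "u x - u y" "v x - v y"] p_gt_1 by (simp add: algebra_simps)
  from divide_right_mono[OF this] show ?thesis
    by (simp add: integrand_eq add_divide_distrib)
qed

lemma Wsp_add:
  assumes u: "u \<in> Wsp" and v: "v \<in> Wsp"
  shows "(\<lambda>x. u x + v x) \<in> Wsp"
proof -
  note [measurable] = WspD(1)[OF u] WspD(1)[OF v]
  \<comment> \<open>The common value \<open>2 powr (p - 1)\<close> of both coefficients in the
    convexity bound at \<open>t = 1 / 2\<close>.\<close>
  let ?c = "(1 - 1 / 2) powr (1 - p) :: real"
  have 1: "(\<lambda>x. u x + v x) \<in> borel_measurable borel"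
    by measurable
  have "integrable lborel (\<lambda>x. \<bar>u x + v x\<bar> powr p)"
  proof (rule Bochner_Integration.integrable_bound)
    show "integrable lborel (\<lambda>x. ?c * \<bar>u x\<bar> powr p + ?c * \<bar>v x\<bar> powr p)"
      using WspD(2)[OF u] WspD(2)[OF v] by simp
    show "AE x in lborel. norm (\<bar>u x + v x\<bar> powr p) \<le> norm (?c * \<bar>u x\<bar> powr p + ?c * \<bar>v x\<bar> powr p)"
      using powr_abs_add_le[of "1 / 2" p] p_gt_1 by (intro AE_I2) auto
  qed measurable
  moreover have "integrable (lborel \<Otimes>\<^sub>M lborel) (integrand (\<lambda>x. u x + v x))"
  proof (rule Bochner_Integration.integrable_bound)
    show "integrable (lborel \<Otimes>\<^sub>M lborel) (\<lambda>z. ?c * integrand u z + ?c * integrand v z)"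
      using WspD(3)[OF u] WspD(3)[OF v] by simp
    show "AE z in lborel \<Otimes>\<^sub>M lborel. norm (integrand (\<lambda>x. u x + v x) z)
        \<le> norm (?c * integrand u z + ?c * integrand v z)"
      using integrand_add_le[of "1 / 2" u v] by (intro AE_I2) (auto simp: integrand_nonneg)
  qed (rule borel_measurable_integrand[OF 1])
  ultimately show ?thesis
    using 1 by (simp add: W_def)
qed

lemma Wsp_minus_iff: "(\<lambda>x. - u x) \<in> Wsp \<longleftrightarrow> u \<in> Wsp"
proof -
  have "integrand (\<lambda>x. - u x) = integrand u"
    by (simp add: fun_eq_iff integrand_eq abs_minus_commute)
  moreover have "(\<lambda>x. - u x) \<in> borel_measurable lborel \<longleftrightarrow> u \<in> borel_measurable lborel"
    using borel_measurable_uminus[of u lborel] borel_measurable_uminus[of "\<lambda>x. - u x" lborel] by auto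
  ultimately show ?thesis
    by (simp add: W_def)
qed

lemma Wsp_diff:
  assumes "u \<in> Wsp" "v \<in> Wsp"
  shows "(\<lambda>x. u x - v x) \<in> Wsp"
  using Wsp_add[of u "\<lambda>x. - v x"] assms by (simp add: Wsp_minus_iff)

text \<open>Stands in for the Minkowski inequality: letting \<open>t\<close> tend to 0, slowly
  compared with the size of \<open>v\<close>, bounds the seminorm of a perturbation of
  \<open>u\<close> by that of \<open>u\<close> up to a vanishing error.\<close>

lemma semi_add_le:
  assumes u: "u \<in> Wsp" and v: "v \<in> Wsp" and t: "0 < t" "t < 1"
  shows "semi (\<lambda>x. u x + v x) \<le> (1 - t) powr (1 - p) * semi u + t powr (1 - p) * semi v"
proof -
  note i = WspD(3)[OF u] WspD(3)[OF v]
  have "semi (\<lambda>x. u x + v x) \<le>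
      (LINT z|(lborel \<Otimes>\<^sub>M lborel). (1 - t) powr (1 - p) * integrand u z + t powr (1 - p) * integrand v z)"
    unfolding seminorm_pow_def using WspD(3)[OF Wsp_add[OF u v]] i
    by (intro integral_mono) (auto simp: integrand_add_le t)
  also have "\<dots> = (1 - t) powr (1 - p) * semi u + t powr (1 - p) * semi v"
    using i by (simp add: seminorm_pow_def)
  finally show ?thesis .
qed

lemma power_integral_add_le:
  assumes u: "u \<in> Wsp" and v: "v \<in> Wsp" and t: "0 < t" "t < 1"
  shows "power_integral p (\<lambda>x. u x + v x) \<le>
    (1 - t) powr (1 - p) * power_integral p u + t powr (1 - p) * power_integral p v"
proof -
  note i = WspD(2)[OF u] WspD(2)[OF v]
  have "power_integral p (\<lambda>x. u x + v x) \<le>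
      (LINT x|lborel. (1 - t) powr (1 - p) * \<bar>u x\<bar> powr p + t powr (1 - p) * \<bar>v x\<bar> powr p)"
    unfolding power_integral_def using WspD(2)[OF Wsp_add[OF u v]] i p_gt_1
    by (intro integral_mono) (auto simp: powr_abs_add_le t)
  also have "\<dots> = (1 - t) powr (1 - p) * power_integral p u + t powr (1 - p) * power_integral p v"
    using i by (simp add: power_integral_def)
  finally show ?thesis .
qed

text \<open>The whole space has infinite Lebesgue measure, so no nonzero constant has an integrable
  power.\<close>

lemma Lp_constant_eq_0:
  assumes "AE x in lborel. u x = (c::real)" "integrable lborel (\<lambda>x :: real^'n. \<bar>u x\<bar> powr t)"
    "u \<in> borel_measurable borel"
  shows "c = 0"
proof -
  note [measurable] = assms(3)
  have "integrable lborel (\<lambda>x :: real^'n. \<bar>c\<bar> powr t)"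
    using assms(1,2) by (subst integrable_cong_AE[of _ _ "\<lambda>x. \<bar>u x\<bar> powr t"]) auto
  then show ?thesis
    by (auto simp: integrable_iff_bounded ennreal_mult_eq_top_iff ennreal_mult_top split: if_splits)
qed

text \<open>A vanishing seminorm makes \<open>u x = u y\<close> for almost every pair. Fixing a
  suitable \<open>x\<close> by Fubini shows that \<open>u\<close> is constant almost everywhere, and
  integrability makes the constant 0.\<close>

lemma is_zero_if_semi_eq_0:
  assumes u: "u \<in> Wsp" and "semi u = 0"
  shows "is_zero u"
proof -
  have pair: "pair_sigma_finite (lborel :: (real^'n) measure) (lborel :: (real^'n) measure)"
    by unfold_locales
  have "AE z in lborel \<Otimes>\<^sub>M lborel. integrand u z = 0"
    using assms integral_nonneg_eq_0_iff_AE[OF WspD(3)[OF u]]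
    by (simp add: seminorm_pow_def integrand_nonneg)
  \<comment> \<open>The quotient is also 0 where its denominator vanishes, but that happens only on
    the diagonal, where the two values agree.\<close>
  then have "AE z in lborel \<Otimes>\<^sub>M lborel. u (fst z) = u (snd z)"
    by eventually_elim (auto simp: integrand_eq \<nu>_diff_eq_0_iff)
  from pair_sigma_finite.AE_pair[OF pair this]
  have "AE x in lborel. AE y in lborel. u x = u y"
    by simp
  then obtain x where "AE y in lborel. u x = u y"
    using eventually_happens'[of "ae_filter (lborel :: (real^'n) measure)"]
    by (auto simp: ae_filter_eq_bot_iff)
  then have x: "AE y in lborel. u y = u x"
    by (rule eventually_mono) simp
  then have "u x = 0"
    using WspD(2,1)[OF u] by (rule Lp_constant_eq_0)
  with x show ?thesis
    by (simp add: is_zero_def)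
qed

lemma is_zero_if_power_integral_eq_0:
  assumes "power_integral t u = 0" "integrable lborel (\<lambda>x. \<bar>u x\<bar> powr t)"
  shows "is_zero u"
  using assms integral_nonneg_eq_0_iff_AE[OF assms(2)] by (simp add: power_integral_def is_zero_def)

section \<open>Scaling laws and invariance of the function spaces\<close>

lemma power_integral_rescale:
  assumes [measurable]: "u \<in> borel_measurable borel" and int: "integrable lborel (\<lambda>x. \<bar>u x\<bar> powr t)"
    and r: "r > 0"
  shows "integrable lborel (\<lambda>x. \<bar>c * u (dilation \<sigma> r x)\<bar> powr t)"
    "power_integral t (\<lambda>x. c * u (dilation \<sigma> r x)) = \<bar>c\<bar> powr t * r powr (-Q) * power_integral t u"
proof -
  have rescale: "integrable lborel (\<lambda>x. \<bar>u (dilation \<sigma> r x)\<bar> powr t)"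
    "(LINT x|lborel. \<bar>u (dilation \<sigma> r x)\<bar> powr t) = power_integral t u / r powr Q"
    unfolding power_integral_def
    by (rule integral_rescale[OF int],
        use r nn_integral_dilation[of "\<lambda>x. ennreal (\<bar>u x\<bar> powr t)" r \<sigma>] in
        \<open>auto simp: power_sum_layers\<close>)+
  then show "integrable lborel (\<lambda>x. \<bar>c * u (dilation \<sigma> r x)\<bar> powr t)"
    by (simp add: abs_mult powr_mult)
  show "power_integral t (\<lambda>x. c * u (dilation \<sigma> r x)) = \<bar>c\<bar> powr t * r powr (-Q) * power_integral t u"
    using rescale by (simp add: power_integral_def abs_mult powr_mult powr_minus_divide)
qed

text \<open>The kernel contributes \<open>r powr (Q + p * s)\<close> and the two changes of
  variables contribute \<open>r powr (-Q)\<close> each.\<close>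

lemma semi_rescale:
  assumes u: "u \<in> Wsp" and r: "r > 0"
  shows "integrable (lborel \<Otimes>\<^sub>M lborel) (integrand (\<lambda>x. c * u (dilation \<sigma> r x)))"
    "semi (\<lambda>x. c * u (dilation \<sigma> r x)) = \<bar>c\<bar> powr p * r powr (p * s - Q) * semi u"
proof -
  let ?D = "\<lambda>z. (dilation \<sigma> r (fst z), dilation \<sigma> r (snd z))"
  have meas: "integrand u \<in> borel_measurable (lborel \<Otimes>\<^sub>M lborel)"
    by (rule borel_measurable_integrand[OF WspD(1)[OF u]])
  have eq: "integrand (\<lambda>x. c * u (dilation \<sigma> r x)) z =
      \<bar>c\<bar> powr p * r powr (Q + p * s) * integrand u (?D z)" for z
    using r \<nu>_diff_dilation[OF r]
    by (simp add: integrand_eq abs_mult powr_mult \<nu>_nonneg flip: right_diff_distrib)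
  have D[measurable]: "?D \<in> (lborel \<Otimes>\<^sub>M lborel) \<rightarrow>\<^sub>M (lborel \<Otimes>\<^sub>M lborel)"
    using borel_measurable_dilation[of \<sigma> r] by (intro measurable_Pair) auto
  have "(\<lambda>z. integrand u (?D z)) \<in> borel_measurable (lborel \<Otimes>\<^sub>M lborel)"
    by (rule measurable_compose[OF D meas])
  moreover have "(\<integral>\<^sup>+z. ennreal (integrand u z) \<partial>(lborel \<Otimes>\<^sub>M lborel)) =
      ennreal (r powr Q * r powr Q) * (\<integral>\<^sup>+z. ennreal (integrand u (?D z)) \<partial>(lborel \<Otimes>\<^sub>M lborel))"
    using nn_integral_dilation_pair[of "\<lambda>z. ennreal (integrand u z)" r \<sigma>] r meas
    by (simp add: power_sum_layers ennreal_mult mult.assoc)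
  ultimately have rescale: "integrable (lborel \<Otimes>\<^sub>M lborel) (\<lambda>z. integrand u (?D z))"
    "(LINT z|(lborel \<Otimes>\<^sub>M lborel). integrand u (?D z)) = semi u / (r powr Q * r powr Q)"
    unfolding seminorm_pow_def using r
    by (intro integral_rescale[OF WspD(3)[OF u]]; simp add: integrand_nonneg)+
  then show "integrable (lborel \<Otimes>\<^sub>M lborel) (integrand (\<lambda>x. c * u (dilation \<sigma> r x)))"
    unfolding eq[abs_def] by simp
  show "semi (\<lambda>x. c * u (dilation \<sigma> r x)) = \<bar>c\<bar> powr p * r powr (p * s - Q) * semi u"
    using rescale r by (simp add: seminorm_pow_def eq powr_diff powr_add)
qed

lemma Wsp_rescale:
  assumes u: "u \<in> Wsp" and r: "r > 0"
  shows "(\<lambda>x. c * u (dilation \<sigma> r x)) \<in> Wsp"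
proof -
  note [measurable] = WspD(1)[OF u]
  have "(\<lambda>x. c * u (dilation \<sigma> r x)) \<in> borel_measurable borel"
    by measurable
  then show ?thesis
    using power_integral_rescale(1)[OF WspD(1,2)[OF u] r] semi_rescale(1)[OF u r]
    by (simp add: W_def)
qed

text \<open>The two parts of the norm scale differently. Bounding both factors by their sum is crude
  but shows continuity of the rescaling, which is what carries density over to rescaled
  functions.\<close>

lemma Wnorm_rescale_le:
  assumes u: "u \<in> Wsp" and r: "r > 0"
  shows "Wnorm (\<lambda>x. c * u (dilation \<sigma> r x)) \<le>
    (\<bar>c\<bar> powr p * (r powr (-Q) + r powr (p * s - Q))) powr (1 / p) * Wnorm u"
proof -
  have "power_integral p (\<lambda>x. c * u (dilation \<sigma> r x)) + semi (\<lambda>x. c * u (dilation \<sigma> r x))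
      \<le> \<bar>c\<bar> powr p * (r powr (-Q) + r powr (p * s - Q)) * (power_integral p u + semi u)"
    by (simp add: semi_rescale[OF u r] power_integral_rescale[OF WspD(1,2)[OF u] r] algebra_simps
        semi_nonneg power_integral_nonneg)
  from powr_mono2[OF _ _ this, of "1 / p"] show ?thesis
    using p_gt_1 by (simp add: W_norm_def powr_mult semi_nonneg power_integral_nonneg)
qed

lemma W0sp_subset: "W0sp \<subseteq> Wsp"
  by (auto simp: W0_def)

lemma test_functions_subset_W0sp: "test_functions \<inter> Wsp \<subseteq> W0sp"
proof -
  have "Wnorm (\<lambda>x. 0) = 0"
    by (simp add: W_norm_def power_integral_def seminorm_pow_def integrand_eq)
  then have "\<exists>\<psi> \<in> test_functions \<inter> Wsp. Wnorm (\<lambda>x. f x - \<psi> x) < \<epsilon>"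
    if "f \<in> test_functions \<inter> Wsp" "\<epsilon> > 0" for f \<epsilon>
    using that by (intro bexI[of _ f]) auto
  then show ?thesis
    by (auto simp: W0_def)
qed

lemma W0sp_rescale:
  assumes u: "u \<in> W0sp" and r: "r > 0"
  shows "(\<lambda>x. c * u (dilation \<sigma> r x)) \<in> W0sp"
proof -
  let ?K = "(\<bar>c\<bar> powr p * (r powr (-Q) + r powr (p * s - Q))) powr (1 / p)"
  have uW: "u \<in> Wsp"
    using u W0sp_subset by blast
  have "\<exists>\<psi> \<in> test_functions \<inter> Wsp. Wnorm (\<lambda>x. c * u (dilation \<sigma> r x) - \<psi> x) < \<epsilon>"
    if "\<epsilon> > 0" for \<epsilon>
  proof -
    have K: "?K \<ge> 0"
      by simp
    \<comment> \<open>The added 1 covers \<open>?K = 0\<close>, which occurs for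
      \<open>c = 0\<close>.\<close>
    then have "\<epsilon> / (?K + 1) > 0"
      using \<open>\<epsilon> > 0\<close> by (simp add: add_nonneg_pos)
    then obtain \<psi> where \<psi>: "\<psi> \<in> test_functions" "\<psi> \<in> Wsp" "Wnorm (\<lambda>x. u x - \<psi> x) < \<epsilon> / (?K + 1)"
      using u unfolding W0_def by blast
    have "Wnorm (\<lambda>x. c * u (dilation \<sigma> r x) - c * \<psi> (dilation \<sigma> r x)) \<le> ?K * Wnorm (\<lambda>x. u x - \<psi> x)"
      using Wnorm_rescale_le[OF Wsp_diff[OF uW \<psi>(2)] r, of c] by (simp add: right_diff_distrib)
    also have "\<dots> \<le> ?K * (\<epsilon> / (?K + 1))"
      using \<psi>(3) by (intro mult_left_mono) auto
    also have "\<dots> < \<epsilon>"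
      using \<open>\<epsilon> > 0\<close> K by (simp add: field_simps del: powr_ge_zero)
    finally show ?thesis
      using test_functions_scaled_dilation[OF \<psi>(1) r, of c \<sigma>] Wsp_rescale[OF \<psi>(2) r, of c]
      by (intro bexI[of _ "\<lambda>x. c * \<psi> (dilation \<sigma> r x)"]) auto
  qed
  then show ?thesis
    using Wsp_rescale[OF uW r] by (auto simp: W0_def)
qed

end

section \<open>The Nehari set and density of test functions\<close>

locale subcritical = fractional_sobolev G k \<sigma> \<nu> Q s p
  for G :: "(real^'n) monoid" and k \<sigma> \<nu> Q s p +
  fixes q :: real
  assumes p_less_q: "p < q" and q_less: "q < Q * p / (Q - p * s)" and ps_less_Q: "p * s < Q"
begin

text \<open>The interpolation exponent with \<open>1 / q = \<theta> * (Q - p * s) / (Q * p) + (1 -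
  \<theta>) / p\<close>. Subcriticality of \<open>q\<close> is the bound
  \<open>\<theta> < 1\<close>.\<close>

definition \<theta> :: real where
  "\<theta> = Q * (q - p) / (p * q * s)"

lemma \<theta>_bounds: "0 < \<theta>" "\<theta> < 1"
proof -
  have pos: "p * q * s > 0"
    using p_gt_1 p_less_q s_pos by simp
  then show "0 < \<theta>"
    using Q_pos p_less_q by (simp add: \<theta>_def)
  have "q * (Q - p * s) < Q * p"
    using q_less ps_less_Q by (simp add: less_divide_eq)
  then show "\<theta> < 1"
    using pos by (simp add: \<theta>_def algebra_simps)
qed

lemma exponents:
  "Q * (q - p) / (s * p\<^sup>2) = \<theta> * (q / p)"
  "(s * p * q - Q * (q - p)) / (s * p\<^sup>2) = (1 - \<theta>) * (q / p)"
  using p_gt_1 p_less_q s_pos by (simp_all add: \<theta>_def field_simps power2_eq_square)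

lemma gn_product_eq:
  "gn_product G \<nu> Q s p q u = (semi u powr \<theta> * power_integral p u powr (1 - \<theta>)) powr (q / p)"
  unfolding gn_product_def exponents by (simp add: powr_powr powr_mult)

lemma gn_product_nonneg: "gn_product G \<nu> Q s p q u \<ge> 0"
  by (simp add: gn_product_def)

text \<open>A bound \<open>M\<close> for \<open>f\<close> turns the \<open>q\<close>-th power into a
  multiple of the integrable \<open>p\<close>-th power.\<close>

lemma integrable_power_test_function:
  assumes f: "f \<in> test_functions" "f \<in> Wsp"
  shows "integrable lborel (\<lambda>x. \<bar>f x\<bar> powr q)"
proof -
  obtain M where M: "M > 0" "\<And>x. \<bar>f x\<bar> \<le> M"
    using bounded_test_function[OF f(1)] by metis
  note [measurable] = WspD(1)[OF f(2)]
  show ?thesis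
  proof (rule Bochner_Integration.integrable_bound)
    show "integrable lborel (\<lambda>x. M powr (q - p) * \<bar>f x\<bar> powr p)"
      using WspD(2)[OF f(2)] by simp
    have "\<bar>f x\<bar> powr q \<le> M powr (q - p) * \<bar>f x\<bar> powr p" for x
    proof -
      have "\<bar>f x\<bar> powr q = \<bar>f x\<bar> powr (q - p) * \<bar>f x\<bar> powr p"
        by (simp flip: powr_add)
      also have "\<dots> \<le> M powr (q - p) * \<bar>f x\<bar> powr p"
        using M p_less_q by (intro mult_right_mono powr_mono2) auto
      finally show ?thesis .
    qed
    then show "AE x in lborel. norm (\<bar>f x\<bar> powr q) \<le> norm (M powr (q - p) * \<bar>f x\<bar> powr p)"
      by simp
  qed measurable
qed

section \<open>The Nehari set\<close>

lemma nehari_functional_eq: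
  assumes "u \<in> Wsp" "integrable lborel (\<lambda>x. \<bar>u x\<bar> powr q)"
  shows "nehari_functional G \<nu> Q s p q u = semi u + power_integral p u - power_integral q u"
  using assms WspD(2)[OF assms(1)] by (simp add: nehari_functional_def power_integral_def)

text \<open>
  If \<open>\<bar>u\<bar>\<^sup>q\<close> were not integrable, the integral in \<^const>\<open>nehari_functional\<close> would have the junk
  value \<open>0\<close>, which forces the seminorm to vanish.
\<close>

lemma nehari_set_integrable:
  assumes u: "u \<in> nehari_set G \<nu> Q s p q"
  shows "integrable lborel (\<lambda>x. \<bar>u x\<bar> powr q)"
proof (rule ccontr)
  assume not: "\<not> ?thesis"
  have uW: "u \<in> Wsp" and nz: "\<not> is_zero u" and 0: "nehari_functional G \<nu> Q s p q u = 0"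
    using u W0sp_subset by (auto simp: nehari_set_def)
  have "\<not> integrable lborel (\<lambda>x. \<bar>u x\<bar> powr p - \<bar>u x\<bar> powr q)"
  proof
    assume "integrable lborel (\<lambda>x. \<bar>u x\<bar> powr p - \<bar>u x\<bar> powr q)"
    from Bochner_Integration.integrable_diff[OF WspD(2)[OF uW] this] show False
      using not by simp
  qed
  then have "semi u = 0"
    using 0 by (simp add: nehari_functional_def not_integrable_integral_eq)
  then show False
    using is_zero_if_semi_eq_0[OF uW] nz by blast
qed

lemma semi_pos: "u \<in> Wsp \<Longrightarrow> \<not> is_zero u \<Longrightarrow> semi u > 0"
  using is_zero_if_semi_eq_0 semi_nonneg[of u] by force

lemma power_integral_pos:
  "integrable lborel (\<lambda>x. \<bar>u x\<bar> powr t) \<Longrightarrow> \<not> is_zero u \<Longrightarrow> power_integral t u > 0"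
  using is_zero_if_power_integral_eq_0[of t u] power_integral_nonneg[of t u] by force

text \<open>Eliminating the \<open>q\<close>-integral by the Nehari identity leaves the energy as a
  positive multiple of \<open>semi u + power_integral p u\<close>, equivalently of
  \<open>power_integral q u\<close>.\<close>

lemma nehari_setD:
  assumes u: "u \<in> nehari_set G \<nu> Q s p q"
  shows "u \<in> W0sp" "u \<in> Wsp" "\<not> is_zero u" "semi u > 0" "power_integral p u > 0"
    "power_integral q u = semi u + power_integral p u"
    "energy G \<nu> Q s p q u = (1 / p - 1 / q) * (semi u + power_integral p u)"
proof -
  show *: "u \<in> W0sp" "u \<in> Wsp" "\<not> is_zero u"
    using u W0sp_subset by (auto simp: nehari_set_def)
  then show "semi u > 0" "power_integral p u > 0"
    using semi_pos power_integral_pos[OF WspD(2)] by auto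
  show eq: "power_integral q u = semi u + power_integral p u"
    using nehari_functional_eq[OF *(2) nehari_set_integrable[OF u]] u
    by (simp add: nehari_set_def)
  show "energy G \<nu> Q s p q u = (1 / p - 1 / q) * (semi u + power_integral p u)"
    by (simp add: energy_def eq algebra_simps)
qed

lemma energy_nehari_bdd_below:
  "bdd_below (energy G \<nu> Q s p q ` nehari_set G \<nu> Q s p q)"
proof (rule bdd_belowI2)
  fix u assume "u \<in> nehari_set G \<nu> Q s p q"
  then show "0 \<le> energy G \<nu> Q s p q u"
    using p_gt_1 p_less_q by (simp add: nehari_setD semi_nonneg power_integral_nonneg frac_le)
qed

text \<open>Testing the weak equation with the solution itself gives the Nehari identity.\<close>

lemma nonzero_solutions_subset_nehari_set:
  "nonzero_solutions G \<nu> Q s p q \<subseteq> nehari_set G \<nu> Q s p q"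
proof
  fix u assume u: "u \<in> nonzero_solutions G \<nu> Q s p q"
  \<comment> \<open>This holds for every exponent, including \<open>a = 0\<close>, since
    \<open>0 powr t = 0\<close>.\<close>
  have eq: "\<bar>a\<bar> powr (t - 2) * a * a = \<bar>a\<bar> powr t" for a t :: real
  proof (cases "a = 0")
    case False
    then have "\<bar>a\<bar> powr t = \<bar>a\<bar> powr (t - 2) * \<bar>a\<bar> powr 2"
      by (subst powr_add[symmetric]) simp
    then show ?thesis
      using False by (simp add: powr_numeral power2_eq_square)
  qed simp
  have "(\<lambda>(x, y). \<bar>u x - u y\<bar> powr (p - 2) * (u x - u y) * (u x - u y)
      / \<nu> (inv\<^bsub>G\<^esub> y \<otimes>\<^bsub>G\<^esub> x) powr (Q + p * s)) = integrand u"
    by (simp add: eq seminorm_integrand_def)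
  moreover have "weak_form G \<nu> Q s p q u u = 0"
    using u by (auto simp: nonzero_solutions_def weak_solution_def)
  ultimately have "nehari_functional G \<nu> Q s p q u = 0"
    by (simp add: weak_form_def nehari_functional_def seminorm_pow_def eq)
  then show "u \<in> nehari_set G \<nu> Q s p q"
    using u by (auto simp: nonzero_solutions_def weak_solution_def nehari_set_def)
qed

text \<open>
  Only upper bounds for the seminorm and the \<open>L\<^sup>p\<close> norm of the approximating functions are needed:
  they come from the convexity of \<open>\<bar>t\<bar>\<^sup>p\<close> (\<open>powr_abs_add_le\<close>), and the left-hand side passes to the
  limit by Fatou's lemma.
\<close>

lemma nn_integral_power_le_if_test_functions:
  assumes c: "c \<ge> 0"
    and test: "\<And>\<psi>. \<psi> \<in> test_functions \<inter> Wsp \<Longrightarrow>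
      (\<integral>\<^sup>+x. ennreal (\<bar>\<psi> x\<bar> powr q) \<partial>lborel) \<le> ennreal (c * gn_product G \<nu> Q s p q \<psi>)"
    and u: "u \<in> W0sp"
  shows "(\<integral>\<^sup>+x. ennreal (\<bar>u x\<bar> powr q) \<partial>lborel) \<le> ennreal (c * gn_product G \<nu> Q s p q u)"
proof -
  \<comment> \<open>The weights tend to 0, so that the coefficient of \<open>u\<close> in the
    convexity bound tends to 1. The tolerance \<open>\<delta> n\<close> is chosen so that its
    product with the diverging coefficient \<open>t n powr (1 - p)\<close> is
    \<open>1 / (n + 1)\<close>.\<close>
  define t where "t n = 1 / (real n + 2)" for n
  define \<delta> where "\<delta> n = 1 / (real n + 1) / t n powr (1 - p)" for n
  have t: "0 < t n" "t n < 1" for n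
    by (auto simp: t_def)
  have \<delta>_pos: "\<delta> n > 0" for n
    using t[of n] by (simp add: \<delta>_def)
  have uW: "u \<in> Wsp"
    using u W0sp_subset by blast
  have "\<exists>\<psi>. \<psi> \<in> test_functions \<inter> Wsp \<and> Wnorm (\<lambda>x. u x - \<psi> x) < \<delta> n powr (1 / p)" for n
  proof -
    have "\<delta> n powr (1 / p) > 0"
      using \<delta>_pos[of n] by simp
    then show ?thesis
      using u unfolding W0_def by blast
  qed
  then obtain \<psi> where \<psi>: "\<And>n. \<psi> n \<in> test_functions \<inter> Wsp"
    "\<And>n. Wnorm (\<lambda>x. u x - \<psi> n x) < \<delta> n powr (1 / p)"
    by metis
  have \<psi>W: "\<psi> n \<in> Wsp" for n
    using \<psi>(1) by blast
  have less: "power_integral p (\<lambda>x. u x - \<psi> n x) + semi (\<lambda>x. u x - \<psi> n x) < \<delta> n" for n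
    using \<psi>(2)[of n] powr_mono2[of "1 / p" "\<delta> n"] \<delta>_pos[of n] p_gt_1
    by (fastforce simp: W_norm_def not_le[symmetric])
  have \<delta>: "power_integral p (\<lambda>x. u x - \<psi> n x) \<le> \<delta> n" "semi (\<lambda>x. u x - \<psi> n x) \<le> \<delta> n" for n
    using less[of n] semi_nonneg[of "\<lambda>x. u x - \<psi> n x"] power_integral_nonneg[of p "\<lambda>x. u x - \<psi> n x"]
    by linarith+
  have commute: "power_integral p (\<lambda>x. \<psi> n x - u x) = power_integral p (\<lambda>x. u x - \<psi> n x)"
    "semi (\<lambda>x. \<psi> n x - u x) = semi (\<lambda>x. u x - \<psi> n x)" for n
    by (simp_all add: power_integral_def seminorm_pow_def integrand_eq abs_minus_commute algebra_simps)
  have t\<delta>: "t n powr (1 - p) * \<delta> n = 1 / (real n + 1)" for n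
    using t[of n] by (simp add: \<delta>_def)
  define \<alpha> where "\<alpha> n = (1 - t n) powr (1 - p)" for n
  have semi_le: "semi (\<psi> n) \<le> \<alpha> n * semi u + 1 / (real n + 1)" for n
    using semi_add_le[OF uW Wsp_diff[OF \<psi>W uW] t, of n n] \<delta>(2)[of n] commute[of n]
      mult_left_mono[OF \<delta>(2), of "t n powr (1 - p)" n] by (simp add: \<alpha>_def t\<delta>)
  have pow_le: "power_integral p (\<psi> n) \<le> \<alpha> n * power_integral p u + 1 / (real n + 1)" for n
    using power_integral_add_le[OF uW Wsp_diff[OF \<psi>W uW] t, of n n] \<delta>(1)[of n] commute[of n]
      mult_left_mono[OF \<delta>(1), of "t n powr (1 - p)" n] by (simp add: \<alpha>_def t\<delta>)
  have t_lim: "t \<longlonglongrightarrow> 0"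
    unfolding t_def by real_asymp
  have \<alpha>_lim: "\<alpha> \<longlonglongrightarrow> 1"
    unfolding \<alpha>_def by (auto intro!: tendsto_eq_intros t_lim)
  have inv_lim: "(\<lambda>n. 1 / (real n + 1)) \<longlonglongrightarrow> 0"
    by real_asymp
  \<comment> \<open>Convergence in mean of the \<open>p\<close>-th powers of the differences yields
    a subsequence of the test functions converging almost everywhere to \<open>u\<close>.\<close>
  have "(\<lambda>n. LINT x|lborel. norm (\<bar>u x - \<psi> n x\<bar> powr p)) \<longlonglongrightarrow> 0"
  proof (rule tendsto_sandwich[OF _ _ tendsto_const inv_lim])
    have "\<delta> n \<le> 1 / (real n + 1)" for n
    proof -
      have "t n powr (1 - p) \<ge> 1"
        using powr_mono'[of "1 - p" 0 "t n"] t[of n] p_gt_1 by simp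
      then show ?thesis
        unfolding \<delta>_def using t[of n] by (simp add: divide_le_eq mult_le_cancel_left1)
    qed
    then show "\<forall>\<^sub>F n in sequentially. (LINT x|lborel. norm (\<bar>u x - \<psi> n x\<bar> powr p)) \<le> 1 / (real n + 1)"
      using order_trans[OF \<delta>(1)] by (intro always_eventually allI) (simp add: power_integral_def)
  qed auto
  from tendsto_L1_AE_subseq[OF _ this] obtain r :: "nat \<Rightarrow> nat" where r: "strict_mono r"
    and ae: "AE x in lborel. (\<lambda>n. \<bar>u x - \<psi> (r n) x\<bar> powr p) \<longlonglongrightarrow> 0"
    using WspD(2)[OF Wsp_diff[OF uW \<psi>W]] by blast
  from ae have "AE x in lborel. ennreal (\<bar>u x\<bar> powr q) =
      liminf (\<lambda>n. ennreal (\<bar>\<psi> (r n) x\<bar> powr q))"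
  proof eventually_elim
    case (elim x)
    have "(\<lambda>n. (\<bar>u x - \<psi> (r n) x\<bar> powr p) powr (1 / p)) \<longlonglongrightarrow> 0 powr (1 / p)"
      using p_gt_1 by (intro tendsto_powr'[OF elim tendsto_const]) auto
    then have "(\<lambda>n. \<bar>u x - \<psi> (r n) x\<bar>) \<longlonglongrightarrow> 0"
      using p_gt_1 by (simp add: powr_powr)
    then have "(\<lambda>n. u x - (u x - \<psi> (r n) x)) \<longlonglongrightarrow> u x - 0"
      by (intro tendsto_diff tendsto_const) (simp add: tendsto_rabs_zero_iff)
    then have "(\<lambda>n. \<psi> (r n) x) \<longlonglongrightarrow> u x"
      by simp
    then have "(\<lambda>n. \<bar>\<psi> (r n) x\<bar> powr q) \<longlonglongrightarrow> \<bar>u x\<bar> powr q"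
      using p_gt_1 p_less_q by (intro tendsto_powr' tendsto_rabs) auto
    then show ?case
      by (intro lim_imp_Liminf[symmetric] tendsto_ennrealI) auto
  qed
  then have "(\<integral>\<^sup>+x. ennreal (\<bar>u x\<bar> powr q) \<partial>lborel) =
      (\<integral>\<^sup>+x. liminf (\<lambda>n. ennreal (\<bar>\<psi> (r n) x\<bar> powr q)) \<partial>lborel)"
    by (rule nn_integral_cong_AE)
  also have "\<dots> \<le> liminf (\<lambda>n. \<integral>\<^sup>+x. ennreal (\<bar>\<psi> (r n) x\<bar> powr q) \<partial>lborel)"
  proof (rule nn_integral_liminf)
    fix n
    note [measurable] = WspD(1)[OF \<psi>W]
    show "(\<lambda>x. ennreal (\<bar>\<psi> (r n) x\<bar> powr q)) \<in> borel_measurable lborel"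
      by measurable
  qed
  also have "\<dots> \<le> liminf (\<lambda>n. ennreal (c * ((\<alpha> (r n) * semi u + 1 / (real (r n) + 1)) powr \<theta> *
      (\<alpha> (r n) * power_integral p u + 1 / (real (r n) + 1)) powr (1 - \<theta>)) powr (q / p)))"
  proof (intro Liminf_mono always_eventually allI)
    fix n
    show "(\<integral>\<^sup>+x. ennreal (\<bar>\<psi> (r n) x\<bar> powr q) \<partial>lborel) \<le>
        ennreal (c * ((\<alpha> (r n) * semi u + 1 / (real (r n) + 1)) powr \<theta> *
        (\<alpha> (r n) * power_integral p u + 1 / (real (r n) + 1)) powr (1 - \<theta>)) powr (q / p))"
      \<comment> \<open>The product is monotone in the seminorm and in the \<open>p\<close>-integral
        because all exponents are nonnegative.\<close>
      by (rule order_trans[OF test[OF \<psi>(1)]], unfold gn_product_eq,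
          intro ennreal_leI mult_left_mono powr_mono2 mult_mono semi_le pow_le)
         (use \<theta>_bounds p_gt_1 p_less_q c in \<open>auto simp: semi_nonneg power_integral_nonneg\<close>)
  qed
  also have "\<dots> = ennreal (c * gn_product G \<nu> Q s p q u)"
  proof (intro lim_imp_Liminf tendsto_ennrealI)
    have lim: "(\<lambda>n. \<alpha> (r n) * a + 1 / (real (r n) + 1)) \<longlonglongrightarrow> a" for a
      using tendsto_add[OF tendsto_mult[OF LIMSEQ_subseq_LIMSEQ[OF \<alpha>_lim r] tendsto_const, of a]
          LIMSEQ_subseq_LIMSEQ[OF inv_lim r]] by (simp add: o_def)
    have nonneg: "\<alpha> (r n) * a + 1 / (real (r n) + 1) \<ge> 0" if "a \<ge> 0" for a n
      using that by (simp add: \<alpha>_def)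
    show "(\<lambda>n. c * ((\<alpha> (r n) * semi u + 1 / (real (r n) + 1)) powr \<theta> *
        (\<alpha> (r n) * power_integral p u + 1 / (real (r n) + 1)) powr (1 - \<theta>)) powr (q / p))
        \<longlonglongrightarrow> c * gn_product G \<nu> Q s p q u"
      unfolding gn_product_eq using \<theta>_bounds p_gt_1 p_less_q
      by (intro tendsto_mult tendsto_const tendsto_powr' lim)
         (auto intro!: always_eventually nonneg semi_nonneg power_integral_nonneg)
  qed simp
  finally show ?thesis .
qed

end

section \<open>Minimizers on the Nehari set\<close>

text \<open>This \<open>t\<close> is the zero of the derivative of
  \<open>(t * A + B) * t powr (-\<theta>)\<close>, which has the sign of
  \<open>(1 - \<theta>) * A * t - \<theta> * B\<close>.\<close>

lemma powr_mult_eq_at_critical_point: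
  fixes A B \<theta> :: real
  assumes pos: "A > 0" "B > 0" and \<theta>: "0 < \<theta>" "\<theta> < 1"
  defines "t \<equiv> \<theta> * B / ((1 - \<theta>) * A)"
  shows "(t * A + B) * t powr (-\<theta>) =
    A powr \<theta> * B powr (1 - \<theta>) / (\<theta> powr \<theta> * (1 - \<theta>) powr (1 - \<theta>))"
proof -
  have "t * A + B = B / (1 - \<theta>)"
    using assms by (simp add: field_simps)
  moreover have "t powr (-\<theta>) = (1 - \<theta>) powr \<theta> * A powr \<theta> / (\<theta> powr \<theta> * B powr \<theta>)"
    using assms by (simp add: powr_minus powr_divide powr_mult)
  ultimately show ?thesis
    using assms by (simp add: powr_diff field_simps)
qed

text \<open>The right-hand side equals \<open>A + B\<close> at \<open>t = 1\<close>, so 1 is a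
  minimum and the derivative vanishes there. The neighbourhood of radius 1 around 1 contains only
  positive \<open>t\<close>.\<close>

lemma critical_point_at_1:
  fixes A B \<theta> :: real
  assumes "\<And>t. t > 0 \<Longrightarrow> A + B \<le> (t * A + B) * t powr (-\<theta>)"
  shows "(1 - \<theta>) * A = \<theta> * B"
proof -
  have D: "((\<lambda>t. (t * A + B) * t powr (-\<theta>)) has_real_derivative A - \<theta> * (A + B)) (at 1)"
    by (auto intro!: derivative_eq_intros simp: algebra_simps)
  have "A - \<theta> * (A + B) = 0"
    by (rule DERIV_local_min[OF D zero_less_one]) (use assms in auto)
  then show ?thesis
    by (simp add: algebra_simps)
qed

text \<open>The least energy solution enters through minimality on the Nehari set, which permits
  comparison with rescaled functions.\<close>

locale nehari_minimizer = subcritical G k \<sigma> \<nu> Q s p q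
  for G :: "(real^'n) monoid" and k \<sigma> \<nu> Q s p q +
  fixes \<phi> :: "real^'n \<Rightarrow> real"
  assumes \<phi>_nehari: "\<phi> \<in> nehari_set G \<nu> Q s p q"
    and \<phi>_min: "\<And>v. v \<in> nehari_set G \<nu> Q s p q \<Longrightarrow> energy G \<nu> Q s p q \<phi> \<le> energy G \<nu> Q s p q v"
begin

lemmas \<phi> = nehari_setD[OF \<phi>_nehari]

text \<open>On the Nehari set the energy is \<open>1 / p - 1 / q\<close> times the
  \<open>q\<close>-integral, so minimality compares the \<open>q\<close>-integrals of
  \<open>\<phi>\<close> and \<open>v\<close>. The factor \<open>\<mu>\<close> solves
  \<open>\<mu> powr q * C = \<mu> powr p * S\<close>, the common power of \<open>r\<close> having
  cancelled.\<close>

lemma nehari_scaling_le: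
  assumes u: "u \<in> W0sp" "\<not> is_zero u" and int: "integrable lborel (\<lambda>x. \<bar>u x\<bar> powr q)"
    and r: "r > 0"
  shows "power_integral q \<phi> powr (q - p) * power_integral q u powr p \<le>
    (r powr (p * s) * semi u + power_integral p u) powr q * r powr (- (Q * (q - p)))"
proof -
  have uW: "u \<in> Wsp"
    using u(1) W0sp_subset by blast
  define S where "S = r powr (p * s) * semi u + power_integral p u"
  define C where "C = power_integral q u"
  define \<mu> where "\<mu> = (S / C) powr (1 / (q - p))"
  \<comment> \<open>the multiple of \<open>u \<circ> D\<^sub>r\<close> that lies on the Nehari set\<close>
  define v where "v = (\<lambda>x. \<mu> * u (dilation \<sigma> r x))"
  have S: "S > 0"
    using semi_pos[OF uW u(2)] power_integral_pos[OF WspD(2)[OF uW] u(2)] r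
    by (simp add: S_def add_pos_pos)
  have C: "C > 0"
    unfolding C_def using int u(2) by (rule power_integral_pos)
  have \<mu>: "\<mu> > 0"
    using S C by (simp add: \<mu>_def)
  have v0: "v \<in> W0sp"
    unfolding v_def by (rule W0sp_rescale[OF u(1) r])
  have vW: "v \<in> Wsp"
    using v0 W0sp_subset by blast
  have vq: "integrable lborel (\<lambda>x. \<bar>v x\<bar> powr q)" "power_integral q v = \<mu> powr q * r powr (-Q) * C"
    unfolding v_def C_def using power_integral_rescale[OF WspD(1)[OF uW] int r, of \<mu>] \<mu> by auto
  have sum: "semi v + power_integral p v = \<mu> powr p * r powr (-Q) * S"
    using power_integral_rescale(2)[OF WspD(1,2)[OF uW] r, of \<mu>] semi_rescale(2)[OF uW r, of \<mu>] \<mu> r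
    by (simp add: v_def S_def powr_diff powr_minus_divide field_simps)
  have "\<mu> powr (q - p) = S / C"
    using p_less_q S C by (simp add: \<mu>_def powr_powr)
  then have "\<mu> powr q * C = \<mu> powr p * S"
    using C \<mu> by (simp add: powr_diff field_simps)
  then have q_eq: "power_integral q v = semi v + power_integral p v"
    by (simp add: sum vq(2) mult_ac)
  have nz: "\<not> is_zero v"
  proof
    assume "is_zero v"
    then have "power_integral q v = 0"
      unfolding power_integral_def is_zero_def by (subst integral_eq_zero_AE) auto
    then show False
      using vq(2) \<mu> r C by simp
  qed
  have v: "v \<in> nehari_set G \<nu> Q s p q"
    using v0 nz nehari_functional_eq[OF vW vq(1)] q_eq by (simp add: nehari_set_def)
  have "1 / p - 1 / q > 0"
    using p_gt_1 p_less_q by (simp add: field_simps)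
  then have "power_integral q \<phi> \<le> \<mu> powr p * r powr (-Q) * S"
    using \<phi>_min[OF v] by (simp add: \<phi> nehari_setD[OF v] sum flip: sum)
  \<comment> \<open>Raising to the power \<open>q - p\<close> eliminates \<open>\<mu>\<close>, since
    \<open>\<mu> powr (q - p) = S / C\<close>.\<close>
  then have "power_integral q \<phi> powr (q - p) \<le> (\<mu> powr p * r powr (-Q) * S) powr (q - p)"
    using p_less_q by (intro powr_mono2) (auto simp: power_integral_nonneg)
  also have "\<dots> = S powr q * r powr (- (Q * (q - p))) / C powr p"
  proof -
    have "(\<mu> powr p) powr (q - p) = S powr p / C powr p"
      using S C p_less_q by (simp add: \<mu>_def powr_powr powr_divide)
    moreover have "S powr p * S powr (q - p) = S powr q"
      by (simp flip: powr_add)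
    ultimately show ?thesis
      by (simp add: powr_mult powr_powr mult_ac)
  qed
  finally show ?thesis
    using C by (simp add: S_def C_def field_simps)
qed

text \<open>The substitution \<open>r = t powr (1 / (p * s))\<close> makes the seminorm term linear
  in the parameter, and the \<open>q\<close>-th root turns the remaining power into
  \<open>t powr (-\<theta>)\<close>.\<close>

lemma nehari_scaling_le':
  assumes u: "u \<in> W0sp" "\<not> is_zero u" and int: "integrable lborel (\<lambda>x. \<bar>u x\<bar> powr q)"
    and t: "t > 0"
  shows "power_integral q \<phi> powr ((q - p) / q) * power_integral q u powr (p / q) \<le>
    (t * semi u + power_integral p u) * t powr (-\<theta>)"
proof -
  have q: "q > 0"
    using p_gt_1 p_less_q by simp
  have "power_integral q \<phi> powr (q - p) * power_integral q u powr p \<le>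
      (t * semi u + power_integral p u) powr q * t powr (- (\<theta> * q))"
    using nehari_scaling_le[OF u int, of "t powr (1 / (p * s))"] t p_gt_1 s_pos q
    by (simp add: powr_powr \<theta>_def)
  then have "(power_integral q \<phi> powr (q - p) * power_integral q u powr p) powr (1 / q) \<le>
      ((t * semi u + power_integral p u) powr q * t powr (- (\<theta> * q))) powr (1 / q)"
    using q by (intro powr_mono2) auto
  then show ?thesis
    using t q by (simp add: powr_mult powr_powr semi_nonneg power_integral_nonneg)
qed

text \<open>For \<open>u = \<phi>\<close> the left-hand side of the scaling inequality collapses to
  the \<open>q\<close>-integral of \<open>\<phi>\<close>, which is
  \<open>semi \<phi> + power_integral p \<phi>\<close> by the Nehari identity.\<close>

lemma pohozaev: "(1 - \<theta>) * semi \<phi> = \<theta> * power_integral p \<phi>"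
proof (rule critical_point_at_1)
  fix t :: real assume "t > 0"
  have "(q - p) / q + p / q = 1"
    using p_gt_1 p_less_q by (simp add: field_simps)
  then show "semi \<phi> + power_integral p \<phi> \<le> (t * semi \<phi> + power_integral p \<phi>) * t powr (-\<theta>)"
    using nehari_scaling_le'[OF \<phi>(1,3) nehari_set_integrable[OF \<phi>_nehari] \<open>t > 0\<close>] \<phi>(4,5,6)
    by (simp flip: powr_add)
qed

section \<open>The sharp constant\<close>

definition level :: real where
  "level = gn_product G \<nu> Q s p q \<phi> / power_integral q \<phi>"

lemma level_pos: "level > 0"
  using \<phi> by (simp add: level_def gn_product_def)

text \<open>The scaling inequality is evaluated at the parameter that is optimal for
  \<open>u\<close>. For \<open>\<phi>\<close> the optimal parameter is 1, where equality holds, so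
  the constant \<open>\<kappa>\<close> cancels when the two are compared.\<close>

lemma level_le:
  assumes u: "u \<in> W0sp" "\<not> is_zero u" and int: "integrable lborel (\<lambda>x. \<bar>u x\<bar> powr q)"
  shows "level * power_integral q u \<le> gn_product G \<nu> Q s p q u"
proof -
  define g where "g v = semi v powr \<theta> * power_integral p v powr (1 - \<theta>)" for v
  define \<kappa> where "\<kappa> = \<theta> powr \<theta> * (1 - \<theta>) powr (1 - \<theta>)"
  define E where "E = power_integral q \<phi>"
  have \<kappa>: "\<kappa> > 0"
    using \<theta>_bounds by (simp add: \<kappa>_def)
  have E: "E > 0"
    using \<phi> by (simp add: E_def)
  have pq: "p > 0" "q > 0"
    using p_gt_1 p_less_q by auto
  have uW: "u \<in> Wsp"
    using u(1) W0sp_subset by blast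
  have pos: "semi u > 0" "power_integral p u > 0" "power_integral q u > 0"
    using semi_pos[OF uW u(2)] power_integral_pos[OF WspD(2)[OF uW] u(2)] power_integral_pos[OF int u(2)]
    by auto
  \<comment> \<open>The Pohozaev identity says that the critical parameter of \<open>\<phi>\<close>
    is 1.\<close>
  have 1: "\<theta> * power_integral p \<phi> / ((1 - \<theta>) * semi \<phi>) = 1"
    using \<phi>(4) \<theta>_bounds by (simp flip: pohozaev)
  have "E = g \<phi> / \<kappa>"
    using powr_mult_eq_at_critical_point[OF \<phi>(4,5) \<theta>_bounds] \<phi>(6)
    unfolding 1 by (simp add: E_def g_def \<kappa>_def)
  then have g\<phi>: "g \<phi> powr (q / p) = \<kappa> powr (q / p) * E powr (q / p)"
    using \<kappa> E by (simp add: field_simps flip: powr_mult)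
  have "\<theta> * power_integral p u / ((1 - \<theta>) * semi u) > 0"
    using \<theta>_bounds pos by simp
  from nehari_scaling_le'[OF u int this]
  have "E powr ((q - p) / q) * power_integral q u powr (p / q) \<le> g u / \<kappa>"
    by (simp only: powr_mult_eq_at_critical_point[OF pos(1,2) \<theta>_bounds] E_def g_def \<kappa>_def)
  then have "(E powr ((q - p) / q) * power_integral q u powr (p / q)) powr (q / p)
      \<le> (g u / \<kappa>) powr (q / p)"
    using pq by (intro powr_mono2) auto
  then have "E powr ((q - p) / p) * power_integral q u \<le> g u powr (q / p) / \<kappa> powr (q / p)"
    using pq pos \<kappa> by (simp add: powr_mult powr_powr powr_divide g_def)
  moreover have "E powr ((q - p) / p) = E powr (q / p) / E"
    using pq E by (simp add: diff_divide_distrib powr_diff)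
  ultimately have "g \<phi> powr (q / p) / E * power_integral q u \<le> g u powr (q / p)"
    using \<kappa> by (simp add: g\<phi> field_simps)
  then show ?thesis
    by (simp add: level_def gn_product_eq g_def E_def)
qed

lemma nn_integral_le_level:
  assumes u: "u \<in> W0sp"
  shows "(\<integral>\<^sup>+x. ennreal (\<bar>u x\<bar> powr q) \<partial>lborel) \<le> ennreal (inverse level * gn_product G \<nu> Q s p q u)"
proof (rule nn_integral_power_le_if_test_functions[OF _ _ u])
  show "inverse level \<ge> 0"
    using level_pos by simp
  fix \<psi> assume \<psi>: "\<psi> \<in> test_functions \<inter> Wsp"
  then have int: "integrable lborel (\<lambda>x. \<bar>\<psi> x\<bar> powr q)"
    by (auto intro: integrable_power_test_function)
  have "power_integral q \<psi> \<le> inverse level * gn_product G \<nu> Q s p q \<psi>"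
  proof (cases "is_zero \<psi>")
    case True
    then have "power_integral q \<psi> = 0"
      unfolding power_integral_def is_zero_def by (subst integral_eq_zero_AE) auto
    then show ?thesis
      using level_pos by (simp add: gn_product_nonneg)
  next
    case False
    then show ?thesis
      using level_le[OF _ False int] \<psi> test_functions_subset_W0sp level_pos by (auto simp: field_simps)
  qed
  then show "(\<integral>\<^sup>+x. ennreal (\<bar>\<psi> x\<bar> powr q) \<partial>lborel) \<le> ennreal (inverse level * gn_product G \<nu> Q s p q \<psi>)"
    using nn_integral_eq_integral[OF int] by (auto simp: power_integral_def intro: ennreal_leI)
qed

text \<open>The extended-valued inequality yields integrability afterwards. Without it
  \<open>power_integral q u\<close> could be the default value 0 in the quotient whose infimum is
  taken.\<close>

lemma W0sp_integrable_power:
  assumes "u \<in> W0sp"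
  shows "integrable lborel (\<lambda>x. \<bar>u x\<bar> powr q)"
proof -
  have [measurable]: "u \<in> borel_measurable borel"
    using assms W0sp_subset WspD(1) by blast
  show ?thesis
    using le_less_trans[OF nn_integral_le_level[OF assms] ennreal_less_top]
    unfolding integrable_iff_bounded by simp
qed

text \<open>Admissibility is the inequality just extended to the whole space; any admissible
  constant is bounded below by inserting \<open>\<phi>\<close>.\<close>

lemma gn_constant_eq: "gn_constant G \<nu> Q s p q = inverse level"
  unfolding gn_constant_def
proof (rule Least_equality)
  show "inverse level > 0 \<and> gn_inequality G \<nu> Q s p q (inverse level)"
    using level_pos nn_integral_le_level by (simp add: gn_inequality_def)
  fix C assume C: "C > 0 \<and> gn_inequality G \<nu> Q s p q C"
  then have "ennreal (power_integral q \<phi>) \<le> ennreal (C * gn_product G \<nu> Q s p q \<phi>)"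
    using \<phi>(1) nn_integral_eq_integral[OF nehari_set_integrable[OF \<phi>_nehari]]
    by (fastforce simp: gn_inequality_def power_integral_def)
  then have "power_integral q \<phi> \<le> C * gn_product G \<nu> Q s p q \<phi>"
    using C by (subst (asm) ennreal_le_iff) (auto simp: gn_product_nonneg)
  then show "inverse level \<le> C"
    using level_pos \<phi> by (simp add: level_def zero_less_divide_iff divide_le_eq split: if_splits)
qed

lemma level_eq_INF:
  "level = (INF u\<in>{u \<in> W0sp. \<not> is_zero u}. gn_product G \<nu> Q s p q u / power_integral q u)"
proof (rule cInf_eq_minimum[symmetric])
  show "level \<in> (\<lambda>u. gn_product G \<nu> Q s p q u / power_integral q u) ` {u \<in> W0sp. \<not> is_zero u}"
    using \<phi>(1,3) by (auto simp: level_def)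
  fix a assume "a \<in> (\<lambda>u. gn_product G \<nu> Q s p q u / power_integral q u) ` {u \<in> W0sp. \<not> is_zero u}"
  then obtain u where u: "u \<in> W0sp" "\<not> is_zero u"
    and a: "a = gn_product G \<nu> Q s p q u / power_integral q u"
    by auto
  show "level \<le> a"
    using level_le[OF u] power_integral_pos[OF _ u(2)] W0sp_integrable_power[OF u(1)]
    by (simp add: a le_divide_eq)
qed

section \<open>Explicit value of the constant\<close>

lemma power_integral_q_eq: "power_integral q \<phi> = power_integral p \<phi> / (1 - \<theta>)"
  using pohozaev \<phi>(6) \<theta>_bounds by (simp add: field_simps)

text \<open>The Pohozaev identity expresses both the seminorm and the \<open>q\<close>-integral of
  \<open>\<phi>\<close> through its \<open>p\<close>-integral.\<close>

lemma level_eq: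
  "level = (1 - \<theta>) * (\<theta> / (1 - \<theta>)) powr (\<theta> * (q / p)) * power_integral p \<phi> powr ((q - p) / p)"
proof -
  let ?P = "power_integral p \<phi>"
  have pq: "p > 0" "q > 0"
    using p_gt_1 p_less_q by auto
  have "semi \<phi> = \<theta> / (1 - \<theta>) * ?P"
    using pohozaev \<theta>_bounds by (simp add: field_simps)
  then have "gn_product G \<nu> Q s p q \<phi> =
      ((\<theta> / (1 - \<theta>)) powr \<theta> * (?P powr \<theta> * ?P powr (1 - \<theta>))) powr (q / p)"
    by (simp add: gn_product_eq powr_mult powr_divide)
  also have "?P powr \<theta> * ?P powr (1 - \<theta>) = ?P"
    using \<phi>(5) by (simp flip: powr_add)
  finally have "gn_product G \<nu> Q s p q \<phi> = (\<theta> / (1 - \<theta>)) powr (\<theta> * (q / p)) * ?P powr (q / p)"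
    by (simp add: powr_mult powr_powr)
  moreover have "?P powr ((q - p) / p) = ?P powr (q / p) / ?P"
    using pq \<phi>(5) by (simp add: diff_divide_distrib powr_diff)
  ultimately show ?thesis
    using \<theta>_bounds by (simp add: level_def power_integral_q_eq)
qed

end

theorem theorem1p3:
  fixes G :: "(real^'n) monoid" and k :: nat and \<sigma> :: "'n \<Rightarrow> nat"
    and \<nu> :: "real^'n \<Rightarrow> real" and \<phi> :: "real^'n \<Rightarrow> real"
    and Q s p q d :: real
  assumes "stratified_group G k \<sigma>"
    and "Q = real (homogeneous_dim k \<sigma>)"
    and "homogeneous_quasi_norm G \<sigma> \<nu>"
    and "0 < s" and "s < 1" and "1 < p" and "Q > p * s"
    and "p < q" and "q < Q * p / (Q - p * s)"
    and "least_energy_solution G \<nu> Q s p q \<phi>"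
    and "d = energy G \<nu> Q s p q \<phi>"
    and "d = (INF u\<in>nehari_set G \<nu> Q s p q. energy G \<nu> Q s p q u)"
  shows "inverse (gn_constant G \<nu> Q s p q) =
           (INF u\<in>{u \<in> W0 G \<nu> Q s p. \<not> is_zero u}.
              gn_product G \<nu> Q s p q u / power_integral q u) \<and>
         inverse (gn_constant G \<nu> Q s p q) =
           (p * q * s - Q * (q - p)) / (p * q * s) *
           (Q * (q - p) / (p * q * s - Q * (q - p))) powr (Q * (q - p) / (s * p\<^sup>2)) *
           Lp_norm p \<phi> powr (q - p) \<and>
         inverse (gn_constant G \<nu> Q s p q) =
           (p * q * s - Q * (q - p)) / (p * q * s) *
           (Q * (q - p) / (p * q * s - Q * (q - p))) powr (Q * (q - p) / (s * p\<^sup>2)) *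
           ((p * q * s - Q * (q - p)) / ((q - p) * s) * d) powr ((q - p) / p)"
proof -
  interpret subcritical G k \<sigma> \<nu> Q s p q
    using assms
    by (intro subcritical.intro fractional_sobolev.intro fractional_sobolev_axioms.intro
        subcritical_axioms.intro) auto
  have \<phi>N: "\<phi> \<in> nehari_set G \<nu> Q s p q"
    using assms(10) nonzero_solutions_subset_nehari_set by (auto simp: least_energy_solution_def)
  interpret nehari_minimizer G k \<sigma> \<nu> Q s p q \<phi>
  proof
    fix v assume "v \<in> nehari_set G \<nu> Q s p q"
    then show "energy G \<nu> Q s p q \<phi> \<le> energy G \<nu> Q s p q v"
      \<comment> \<open>Boundedness below makes the real infimum \<open>d\<close> a genuine lower
        bound for the energies.\<close>
      using assms(11,12) cINF_lower[OF energy_nehari_bdd_below] by simp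
  qed (rule \<phi>N)
  let ?P = "power_integral p \<phi>"
  have pos: "p > 0" "q > 0" "s > 0" "q - p > 0" "p * q * s > 0"
    using p_gt_1 p_less_q s_pos by auto
  have one_minus: "(p * q * s - Q * (q - p)) / (p * q * s) = 1 - \<theta>"
    using pos by (simp add: \<theta>_def diff_divide_distrib)
  then have ratio: "Q * (q - p) / (p * q * s - Q * (q - p)) = \<theta> / (1 - \<theta>)"
    using pos \<theta>_bounds by (simp add: \<theta>_def divide_simps)
  have norm: "Lp_norm p \<phi> powr (q - p) = ?P powr ((q - p) / p)"
    by (simp add: Lp_norm_def powr_powr)
  \<comment> \<open>Solving this for \<open>?P\<close> converts the formula in the norm of
    \<open>\<phi>\<close> into the one in \<open>d\<close>.\<close>
  have "d = (1 / p - 1 / q) * (?P / (1 - \<theta>))"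
    using assms(11) \<phi>(6,7) power_integral_q_eq by simp
  moreover have "(p * q * s - Q * (q - p)) / ((q - p) * s) = p * q / (q - p) * (1 - \<theta>)"
    using pos by (simp flip: one_minus)
  moreover have "1 / p - 1 / q = (q - p) / (p * q)"
    using pos by (simp add: field_simps)
  ultimately have d: "(p * q * s - Q * (q - p)) / ((q - p) * s) * d = ?P"
    using pos \<theta>_bounds by simp
  show ?thesis
    unfolding d norm exponents(1) ratio one_minus gn_constant_eq inverse_inverse_eq
    using level_eq_INF level_eq by simp
qed

end
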